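(* Let $Z \subset \mathbb{P}V$ be an Euler-symmetric projective variety. Then $Z$ is quasi-homogeneous, i.e., the linear automorphism group $\mathrm{Aut}(Z) \subset \mathbf{PGL}(V)$ (the group of projective transformations of $\mathbb{P}V$ preserving $Z$) acts on $Z$ with a dense open orbit.
   Context: Everything is over $\mathbb{C}$; $V$ is a finite-dimensional complex vector space, $\mathbb{P}V$ is the projective space of one-dimensional subspaces of $V$, and varieties are irreducible. Let $Z \subset \mathbb{P}V$ be a projective variety. For a nonsingular point $x \in Z$, a $\mathbb{C}^{\times}$-action on $Z$ coming from a multiplicative subgroup of $\mathbf{GL}(V)$ (i.e. a one-parameter algebraic subgroup isomorphic to $\mathbb{C}^\times$ preserving $Z$) is said to be of Euler type at $x$ if $x$ is an isolated fixed point of the induced action on $Z$ and the isotropic action on the tangent space $T_xZ$ is by scalar multiplication (i.e., the induced action on $\mathbb{P}T_xZ$ is trivial). $Z \subset \mathbb{P}V$ is Euler-symmetric if for a general point $x \in Z$ there exists a $\mathbb{C}^{\times}$-action on $Z$ of Euler type at $x$. "General point" means any point in some nonempty Zariski-open subset. *)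

theory Defs
  imports "HOL-Analysis.Analysis" "HOL-Computational_Algebra.Polynomial" "HOL-Library.Extended_Nat"
begin

text \<open>The vector space \<open>V\<close> is \<^typ>\<open>complex ^ 'n\<close>, with its complex vector space structure (the
  locale prefix \<open>vec\<close>; the unprefixed \<open>span\<close>, \<open>dim\<close>, \<open>subspace\<close> are the real ones).\<close>

subsection \<open>Projective space and its Zariski topology\<close>

definition proj_space :: "(complex ^ 'n) set set" where
  "proj_space = {L. vec.subspace L \<and> vec.dim L = 1}"

inductive_set poly_funs :: "(complex ^ 'n \<Rightarrow> complex) set" where
  const: "(\<lambda>v. c) \<in> poly_funs"
| coord: "(\<lambda>v. v $ i) \<in> poly_funs"
| add: "f \<in> poly_funs \<Longrightarrow> g \<in> poly_funs \<Longrightarrow> (\<lambda>v. f v + g v) \<in> poly_funs"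
| mult: "f \<in> poly_funs \<Longrightarrow> g \<in> poly_funs \<Longrightarrow> (\<lambda>v. f v * g v) \<in> poly_funs"

definition homogeneous_polys :: "(complex ^ 'n \<Rightarrow> complex) set" where
  "homogeneous_polys = {f \<in> poly_funs. \<exists>d::nat. \<forall>c v. f (c *s v) = c ^ d * f v}"

definition vanishes_at :: "(complex ^ 'n \<Rightarrow> complex) \<Rightarrow> (complex ^ 'n) set \<Rightarrow> bool" where
  "vanishes_at f L \<longleftrightarrow> (\<forall>v\<in>L. f v = 0)"

definition zero_locus :: "(complex ^ 'n \<Rightarrow> complex) set \<Rightarrow> (complex ^ 'n) set set" where
  "zero_locus S = {L \<in> proj_space. \<forall>f\<in>S. vanishes_at f L}"

definition zariski :: "(complex ^ 'n) set topology" where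
  "zariski = topology (\<lambda>U. U \<subseteq> proj_space \<and>
     (\<exists>S \<subseteq> homogeneous_polys. proj_space - U = zero_locus S))"

lemma homogeneous_polys_mult:
  assumes "f \<in> homogeneous_polys" "g \<in> homogeneous_polys"
  shows "(\<lambda>v. f v * g v) \<in> homogeneous_polys"
proof -
  from assms obtain d e where
    "\<forall>c v. f (c *s v) = c ^ d * f v" "\<forall>c v. g (c *s v) = c ^ e * g v"
    by (auto simp: homogeneous_polys_def)
  then have "\<forall>c v. f (c *s v) * g (c *s v) = c ^ (d + e) * (f v * g v)"
    by (simp add: power_add)
  then show ?thesis
    using assms by (auto simp: homogeneous_polys_def intro: poly_funs.mult)
qed

lemma proj_space_eq_span:
  assumes "L \<in> proj_space"
  obtains v where "v \<noteq> 0" "L = vec.span {v}"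
proof -
  from assms have L: "vec.subspace L" "vec.dim L = 1"
    by (auto simp: proj_space_def)
  from vec.basis_exists[of L] obtain B where
    B: "B \<subseteq> L" "vec.independent B" "L \<subseteq> vec.span B" "card B = vec.dim L" by blast
  with L obtain v where "B = {v}" by (auto simp: card_1_singleton_iff)
  with B L have "v \<noteq> 0" "L = vec.span {v}"
    by (auto simp: vec.dependent_single intro: vec.span_minimal[THEN subsetD])
  then show ?thesis by (rule that)
qed

lemma vanishes_at_mult:
  assumes "f \<in> homogeneous_polys" "g \<in> homogeneous_polys" "L \<in> proj_space"
  shows "vanishes_at (\<lambda>v. f v * g v) L \<longleftrightarrow> vanishes_at f L \<or> vanishes_at g L"
proof
  assume *: "vanishes_at (\<lambda>v. f v * g v) L"
  from assms(3) obtain v where v: "v \<noteq> 0" "L = vec.span {v}" by (rule proj_space_eq_span)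
  from * v have "f v = 0 \<or> g v = 0" by (auto simp: vanishes_at_def vec.span_base)
  then show "vanishes_at f L \<or> vanishes_at g L"
    using assms(1,2) v by (auto simp: homogeneous_polys_def vanishes_at_def vec.span_singleton)
qed (auto simp: vanishes_at_def)

lemma zero_locus_Un_eq:
  assumes "S \<subseteq> homogeneous_polys" "T \<subseteq> homogeneous_polys"
  shows "zero_locus S \<union> zero_locus T = zero_locus {\<lambda>v. f v * g v | f g. f \<in> S \<and> g \<in> T}"
proof -
  have "L \<in> zero_locus S \<union> zero_locus T \<longleftrightarrow>
        L \<in> zero_locus {\<lambda>v. f v * g v | f g. f \<in> S \<and> g \<in> T}" if L: "L \<in> proj_space" for L
  proof -
    have "(\<forall>h\<in>{\<lambda>v. f v * g v | f g. f \<in> S \<and> g \<in> T}. vanishes_at h L) \<longleftrightarrow>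
          (\<forall>f\<in>S. \<forall>g\<in>T. vanishes_at f L \<or> vanishes_at g L)"
      using assms vanishes_at_mult[OF _ _ L] by blast
    then show ?thesis using L unfolding zero_locus_def by blast
  qed
  moreover have "zero_locus R \<subseteq> proj_space" for R :: "(complex ^ 'n \<Rightarrow> complex) set"
    by (auto simp: zero_locus_def)
  ultimately show ?thesis by blast
qed

lemma istopology_zariski:
  "istopology (\<lambda>U. U \<subseteq> proj_space \<and>
     (\<exists>S \<subseteq> homogeneous_polys. proj_space - U = zero_locus S))"
  unfolding istopology_def
proof (intro conjI allI impI; (elim conjE exE)?)
  fix U V :: "(complex ^ 'n) set set" and S T
  assume "U \<subseteq> proj_space" "V \<subseteq> proj_space"
    and S: "S \<subseteq> homogeneous_polys" "proj_space - U = zero_locus S"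
    and T: "T \<subseteq> homogeneous_polys" "proj_space - V = zero_locus T"
  show "U \<inter> V \<subseteq> proj_space" using \<open>U \<subseteq> proj_space\<close> by blast
  have "proj_space - (U \<inter> V) = zero_locus {\<lambda>v. f v * g v | f g. f \<in> S \<and> g \<in> T}"
    using S T zero_locus_Un_eq[OF S(1) T(1)] by blast
  moreover have "{\<lambda>v. f v * g v | f g. f \<in> S \<and> g \<in> T} \<subseteq> homogeneous_polys"
    using S T homogeneous_polys_mult by blast
  ultimately show "\<exists>R\<subseteq>homogeneous_polys. proj_space - (U \<inter> V) = zero_locus R" by blast
next
  fix K :: "(complex ^ 'n) set set set"
  assume K: "\<forall>U\<in>K. U \<subseteq> proj_space \<and> (\<exists>S\<subseteq>homogeneous_polys. proj_space - U = zero_locus S)"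
  then show "\<Union> K \<subseteq> proj_space" by blast
  from K obtain S where
    S: "\<And>U. U \<in> K \<Longrightarrow> S U \<subseteq> homogeneous_polys \<and> proj_space - U = zero_locus (S U)"
    by metis
  have "proj_space - \<Union> K = zero_locus (\<Union> (S ` K))"
    using S unfolding zero_locus_def by blast
  moreover have "\<Union> (S ` K) \<subseteq> homogeneous_polys" using S by blast
  ultimately show "\<exists>R\<subseteq>homogeneous_polys. proj_space - \<Union> K = zero_locus R" by blast
qed

lemma openin_zariski:
  "openin zariski U \<longleftrightarrow> U \<subseteq> proj_space \<and>
     (\<exists>S \<subseteq> homogeneous_polys. proj_space - U = zero_locus S)"
  unfolding zariski_def by (subst topology_inverse'[OF istopology_zariski]) (rule refl)

lemma topspace_zariski: "topspace zariski = proj_space"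
proof
  show "topspace zariski \<subseteq> proj_space"
    unfolding topspace_def by (auto simp: openin_zariski)
  have "zero_locus {\<lambda>v::complex^'n. 1} = {}"
    by (auto simp: zero_locus_def vanishes_at_def proj_space_def)
  moreover have "(\<lambda>v::complex^'n. 1) \<in> homogeneous_polys"
    by (auto simp: homogeneous_polys_def intro: poly_funs.const exI[of _ 0])
  ultimately have "openin zariski (proj_space :: (complex ^ 'n) set set)"
    unfolding openin_zariski by (intro conjI exI[of _ "{\<lambda>v. 1}"]) auto
  then show "proj_space \<subseteq> topspace (zariski :: (complex ^ 'n) set topology)"
    by (rule openin_subset)
qed

lemma closedin_zariski:
  "closedin zariski C \<longleftrightarrow> (\<exists>S \<subseteq> homogeneous_polys. C = zero_locus S)"
proof
  assume "closedin zariski C"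
  then have "C \<subseteq> proj_space" "\<exists>S \<subseteq> homogeneous_polys. proj_space - (proj_space - C) = zero_locus S"
    by (auto simp: closedin_def topspace_zariski openin_zariski)
  then show "\<exists>S \<subseteq> homogeneous_polys. C = zero_locus S" by (simp add: double_diff)
next
  assume "\<exists>S \<subseteq> homogeneous_polys. C = zero_locus S"
  then obtain S where S: "S \<subseteq> homogeneous_polys" "C = zero_locus S" by blast
  then have "C \<subseteq> proj_space" by (auto simp: zero_locus_def)
  with S show "closedin zariski C"
    by (auto simp: closedin_def topspace_zariski openin_zariski double_diff)
qed

subsection \<open>Projective varieties, dimension, tangent spaces\<close>

definition irreducible_closed :: "(complex ^ 'n) set set \<Rightarrow> bool" where
  "irreducible_closed Z \<longleftrightarrow> closedin zariski Z \<and> Z \<noteq> {} \<and>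
     (\<forall>A B. closedin zariski A \<and> closedin zariski B \<and> Z = A \<union> B \<longrightarrow> Z = A \<or> Z = B)"

abbreviation projective_variety :: "(complex ^ 'n) set set \<Rightarrow> bool" where
  "projective_variety \<equiv> irreducible_closed"

text \<open>Krull dimension: supremum of the lengths of chains of irreducible closed subsets.\<close>
definition variety_dim :: "(complex ^ 'n) set set \<Rightarrow> enat" where
  "variety_dim Z = Sup {enat d | d. \<exists>C. (\<forall>i\<le>d. irreducible_closed (C i) \<and> C i \<subseteq> Z) \<and>
                                      (\<forall>i<d. C i \<subset> C (Suc i))}"

definition homogeneous_ideal :: "(complex ^ 'n) set set \<Rightarrow> (complex ^ 'n \<Rightarrow> complex) set" where
  "homogeneous_ideal Z = {f \<in> homogeneous_polys. \<forall>L\<in>Z. vanishes_at f L}"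

text \<open>The Zariski tangent space of the affine cone over \<open>Z\<close> at a nonzero vector of the line \<open>x\<close>
  (the same for all of them). The tangent space \<open>T\<^sub>x Z\<close> is its quotient by the line \<open>x\<close>.\<close>
definition cone_tangent_space :: "(complex ^ 'n) set set \<Rightarrow> (complex ^ 'n) set \<Rightarrow> (complex ^ 'n) set"
  where
  "cone_tangent_space Z x =
     {w. \<forall>f\<in>homogeneous_ideal Z. \<forall>v\<in>x - {0}. deriv (\<lambda>s. f (v + s *s w)) 0 = 0}"

text \<open>\<open>dim T\<^sub>x Z = dim Z\<close>, where the left-hand side is \<open>vec.dim (cone_tangent_space Z x) - 1\<close>.\<close>
definition nonsingular_point :: "(complex ^ 'n) set set \<Rightarrow> (complex ^ 'n) set \<Rightarrow> bool" where
  "nonsingular_point Z x \<longleftrightarrow> x \<in> Z \<and> enat (vec.dim (cone_tangent_space Z x)) = variety_dim Z + 1"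

subsection \<open>Projective transformations\<close>

definition proj_map :: "complex ^ 'n ^ 'n \<Rightarrow> (complex ^ 'n) set \<Rightarrow> (complex ^ 'n) set" where
  "proj_map g = (\<lambda>L\<in>proj_space. (\<lambda>v. g *v v) ` L)"

text \<open>Elements of \<open>PGL(V) = GL(V) / scalars\<close> are identified with the maps of \<open>PV\<close> they induce;
  \<^const>\<open>proj_map\<close> is restricted to \<open>PV\<close> so that proportional matrices give equal maps.\<close>
definition PGL :: "((complex ^ 'n) set \<Rightarrow> (complex ^ 'n) set) set" where
  "PGL = {proj_map g | g. invertible g}"

definition Aut :: "(complex ^ 'n) set set \<Rightarrow> ((complex ^ 'n) set \<Rightarrow> (complex ^ 'n) set) set" where
  "Aut Z = {\<phi> \<in> PGL. \<phi> ` Z = Z}"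

definition Aut_orbit :: "(complex ^ 'n) set set \<Rightarrow> (complex ^ 'n) set \<Rightarrow> (complex ^ 'n) set set" where
  "Aut_orbit Z x = {\<phi> x | \<phi>. \<phi> \<in> Aut Z}"

definition quasi_homogeneous :: "(complex ^ 'n) set set \<Rightarrow> bool" where
  "quasi_homogeneous Z \<longleftrightarrow> (\<exists>x\<in>Z. openin (subtopology zariski Z) (Aut_orbit Z x) \<and>
                                   (subtopology zariski Z) closure_of (Aut_orbit Z x) = Z)"

subsection \<open>Actions of Euler type\<close>

text \<open>A multiplicative subgroup of \<open>GL(V)\<close>, given by a parametrisation
  \<open>\<rho> : \<complex>\<^sup>\<times> \<rightarrow> GL(V)\<close>: an injective homomorphism whose matrix entries are regular functions on
  \<open>\<complex>\<^sup>\<times>\<close>, that is, Laurent polynomials. (In characteristic 0 an injective homomorphism of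
  algebraic groups is an isomorphism onto its image.) The value of \<open>\<rho>\<close> at \<open>0\<close> is irrelevant.\<close>
definition multiplicative_subgroup :: "(complex \<Rightarrow> complex ^ 'n ^ 'n) \<Rightarrow> bool" where
  "multiplicative_subgroup \<rho> \<longleftrightarrow>
     (\<forall>t. t \<noteq> 0 \<longrightarrow> invertible (\<rho> t)) \<and>
     (\<forall>s t. s \<noteq> 0 \<and> t \<noteq> 0 \<longrightarrow> \<rho> (s * t) = \<rho> s ** \<rho> t) \<and>
     inj_on \<rho> (- {0}) \<and>
     (\<forall>i j. \<exists>(p :: complex poly) (m :: nat). \<forall>t. t \<noteq> 0 \<longrightarrow> \<rho> t $ i $ j = poly p t / t ^ m)"

definition fixed_points ::
  "(complex \<Rightarrow> complex ^ 'n ^ 'n) \<Rightarrow> (complex ^ 'n) set set \<Rightarrow> (complex ^ 'n) set set" where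
  "fixed_points \<rho> Z = {y \<in> Z. \<forall>t. t \<noteq> 0 \<longrightarrow> proj_map (\<rho> t) y = y}"

text \<open>Let \<open>g\<close> fix the line \<open>x\<close> and preserve \<open>Z\<close>, with \<open>g v = a v\<close> for \<open>v\<close> in \<open>x\<close>. For
  \<open>\<pi> : V - {0} \<rightarrow> PV\<close> one has \<open>d\<pi>\<^sub>v w = d\<pi>\<^sub>a\<^sub>v (a w)\<close>, so under the isomorphism
  \<open>cone_tangent_space Z x / x \<cong> T\<^sub>x Z\<close> induced by \<open>d\<pi>\<^sub>v\<close> the differential of \<open>g\<close> at \<open>x\<close> is
  \<open>w mod x \<mapsto> a\<^sup>-\<^sup>1 g w mod x\<close>. It is required to be multiplication by a scalar \<open>c\<close>.\<close>
definition isotropy_scalar ::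
  "(complex ^ 'n) set set \<Rightarrow> (complex ^ 'n) set \<Rightarrow> complex ^ 'n ^ 'n \<Rightarrow> bool" where
  "isotropy_scalar Z x g \<longleftrightarrow>
     (\<exists>a c. a \<noteq> 0 \<and> (\<forall>v\<in>x. g *v v = a *s v) \<and>
        (\<forall>w\<in>cone_tangent_space Z x. inverse a *s (g *v w) - c *s w \<in> x))"

definition euler_type ::
  "(complex \<Rightarrow> complex ^ 'n ^ 'n) \<Rightarrow> (complex ^ 'n) set set \<Rightarrow> (complex ^ 'n) set \<Rightarrow> bool" where
  "euler_type \<rho> Z x \<longleftrightarrow>
     nonsingular_point Z x \<and>
     multiplicative_subgroup \<rho> \<and> (\<forall>t. t \<noteq> 0 \<longrightarrow> proj_map (\<rho> t) ` Z = Z) \<and>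
     x \<in> fixed_points \<rho> Z \<and> openin (subtopology zariski (fixed_points \<rho> Z)) {x} \<and>
     (\<forall>t. t \<noteq> 0 \<longrightarrow> isotropy_scalar Z x (\<rho> t))"

definition euler_symmetric :: "(complex ^ 'n) set set \<Rightarrow> bool" where
  "euler_symmetric Z \<longleftrightarrow>
     (\<exists>U. openin (subtopology zariski Z) U \<and> U \<noteq> {} \<and>
          (\<forall>x\<in>U. \<exists>\<rho>. euler_type \<rho> Z x))"

end

theory Submission imports Defs begin

text \<open>Let \<open>S\<close> be the affine cone over \<open>Z\<close> and \<open>v\<close> a vector on an Euler point. After a twist, the
  action grades \<open>V\<close> so that \<open>v\<close> has weight \<open>0\<close> and the affine tangent space of \<open>S\<close> at \<open>v\<close> lies in
  \<open>\<complex>v \<oplus> V\<^sub>c\<close> for some \<open>c \<ge> 0\<close>. By Nakayama's lemma the coordinates whose weight cannot be produced by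
  the cotangent space vanish on \<open>S\<close>. If \<open>c = 0\<close>, the action on \<open>Z\<close> is trivial, and \<open>Z\<close> is a point because
  the fixed point is isolated. If \<open>c > 0\<close>, all vectors of \<open>S\<close> have the form \<open>\<kappa> v + w\<close> with \<open>w\<close> of
  weights at least \<open>c\<close>, and a vector of \<open>S\<close> of the form \<open>v + w\<close> whose component in \<open>V\<^sub>c\<close> is zero
  equals \<open>v\<close>, since its lowest remaining term would be tangent.

  Let \<open>\<gg>\<close> be the Lie algebra of linear vector fields tangent to \<open>S\<close>, and choose the Euler point with
  \<open>dim \<gg>v\<close> maximal. The weight derivation kills \<open>v\<close>, but at other points it contributes the
  direction \<open>P\<^sub>c y\<close>; maximality thus forces \<open>P\<^sub>c S\<close> into \<open>\<gg>\<^sub>c v\<close>, with \<open>\<gg>\<^sub>c\<close> the weight \<open>c\<close> part.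
  So for \<open>y = v + w\<close> in \<open>S\<close> some nilpotent \<open>N\<close> in \<open>\<gg>\<^sub>c\<close> makes the \<open>V\<^sub>c\<close>-component of \<open>exp(N) y\<close> vanish,
  hence \<open>exp(N) y = v\<close>: the orbit of the Euler point contains the open set \<open>\<kappa> \<noteq> 0\<close>.\<close>

section \<open>Polynomial functions\<close>

lemma poly_funs_sum:
  assumes "\<And>i. i \<in> A \<Longrightarrow> f i \<in> poly_funs"
  shows "(\<lambda>v. \<Sum>i\<in>A. f i v) \<in> poly_funs"
  using assms
  by (induction A rule: infinite_finite_induct) (auto intro: poly_funs.intros)

lemma poly_funs_prod:
  assumes "\<And>i. i \<in> A \<Longrightarrow> f i \<in> poly_funs"
  shows "(\<lambda>v. \<Prod>i\<in>A. f i v) \<in> poly_funs"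
  using assms
  by (induction A rule: infinite_finite_induct) (auto intro: poly_funs.intros)

lemma poly_funs_cmul: "f \<in> poly_funs \<Longrightarrow> (\<lambda>v. c * f v) \<in> poly_funs"
  by (intro poly_funs.intros)

lemma poly_funs_diff: "f \<in> poly_funs \<Longrightarrow> g \<in> poly_funs \<Longrightarrow> (\<lambda>v. f v - g v) \<in> poly_funs"
  using poly_funs.add[OF _ poly_funs_cmul[of g "-1"], of f] by simp

lemma poly_funs_matrix: "(\<lambda>v. (A *v v) $ i) \<in> poly_funs"
  unfolding matrix_vector_mult_def by (auto intro!: poly_funs_sum poly_funs.intros)

lemma poly_funs_subst:
  assumes "f \<in> poly_funs" "\<And>i. (\<lambda>v. \<phi> v $ i) \<in> poly_funs"
  shows "(\<lambda>v. f (\<phi> v)) \<in> poly_funs"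
  using assms(1) by induction (auto intro: poly_funs.intros assms(2))

lemma poly_funs_det:
  assumes "\<And>i j. (\<lambda>v. a v $ i $ j) \<in> poly_funs"
  shows "(\<lambda>v. det (a v)) \<in> poly_funs"
  unfolding det_def by (intro poly_funs_sum poly_funs_cmul poly_funs_prod assms)

text \<open>Modulo \<open>t ^ c\<close> the curve is constant, and polynomial operations respect
  this congruence. With \<open>c = 0\<close> the content is that \<open>f\<close> along a polynomial
  curve is a polynomial in \<open>t\<close>.\<close>

lemma poly_funs_along_curve:
  assumes "f \<in> poly_funs" and \<gamma>: "\<And>i t. \<gamma> t $ i = a $ i + t ^ c * poly (p i) t"
  shows "\<exists>q. \<forall>t. f (\<gamma> t) = f a + t ^ c * poly q t"
  using assms(1)
proof induction
  case (const b)
  show ?case by (intro exI[of _ 0]) simp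
next
  case (coord i)
  show ?case using \<gamma> by blast
next
  case (add f g)
  then obtain q r where "\<forall>t. f (\<gamma> t) = f a + t ^ c * poly q t" "\<forall>t. g (\<gamma> t) = g a + t ^ c * poly r t"
    by blast
  then show ?case by (intro exI[of _ "q + r"]) (simp add: algebra_simps)
next
  case (mult f g)
  then obtain q r where "\<forall>t. f (\<gamma> t) = f a + t ^ c * poly q t" "\<forall>t. g (\<gamma> t) = g a + t ^ c * poly r t"
    by blast
  then show ?case
    by (intro exI[of _ "smult (f a) r + smult (g a) q + monom 1 c * q * r"])
      (simp add: algebra_simps poly_monom)
qed

section \<open>Gradients and the chain rule\<close>

definition grad :: "(complex ^ 'n \<Rightarrow> complex) \<Rightarrow> complex ^ 'n \<Rightarrow> complex ^ 'n" where
  "grad f y = (\<chi> j. deriv (\<lambda>s. f (y + s *s axis j 1)) 0)"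

text \<open>Bilinear, without complex conjugation, so that pairing with \<open>grad f y\<close> is
  the complex differential of \<open>f\<close> at \<open>y\<close>.\<close>

definition pairing :: "complex ^ 'n \<Rightarrow> complex ^ 'n \<Rightarrow> complex" where
  "pairing a w = (\<Sum>j\<in>UNIV. a $ j * w $ j)"

lemma pairing_add_left: "pairing (a + b) w = pairing a w + pairing b w"
  and pairing_add_right: "pairing a (w + z) = pairing a w + pairing a z"
  and pairing_scale_left: "pairing (c *s a) w = c * pairing a w"
  and pairing_scale_right: "pairing a (c *s w) = c * pairing a w"
  and pairing_zero_left: "pairing 0 w = 0"
  and pairing_zero_right: "pairing a 0 = 0"
  by (simp_all add: pairing_def algebra_simps sum.distrib sum_distrib_left sum_subtractf)

lemma pairing_commute: "pairing a b = pairing b a"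
  by (simp add: pairing_def mult.commute)

lemma pairing_sum_right: "pairing a (\<Sum>i\<in>A. w i) = (\<Sum>i\<in>A. pairing a (w i))"
  by (induction A rule: infinite_finite_induct) (auto simp: pairing_add_right pairing_zero_right)

lemma pairing_axis: "pairing a (axis j 1) = a $ j"
  by (simp add: pairing_def axis_def if_distrib cong: if_cong)

lemma pairing_axis_left: "pairing (axis j 1) a = a $ j"
  using pairing_axis[of a j] by (simp add: pairing_commute)

text \<open>The induction carries a gradient that is visibly polynomial and obeys the chain rule; it
  is identified with \<open>grad\<close> afterwards, by testing on coordinate lines.\<close>

lemma poly_funs_gradient:
  assumes "f \<in> poly_funs"
  shows "\<exists>G. (\<forall>j. (\<lambda>y. G y $ j) \<in> poly_funs) \<and>
    (\<forall>\<gamma> \<gamma>' t. (\<forall>j. ((\<lambda>s. \<gamma> s $ j) has_field_derivative \<gamma>' $ j) (at t)) \<longrightarrow>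
      ((\<lambda>s. f (\<gamma> s)) has_field_derivative pairing (G (\<gamma> t)) \<gamma>') (at t))"
  using assms
proof induction
  case (const b)
  show ?case
    by (intro exI[of _ "\<lambda>_. 0"]) (auto simp: pairing_zero_left intro: poly_funs.const)
next
  case (coord i)
  show ?case
    by (intro exI[of _ "\<lambda>_. axis i 1"]) (auto simp: pairing_axis_left intro: poly_funs.const)
next
  case (add f g)
  then obtain F G where F: "\<And>j. (\<lambda>y. F y $ j) \<in> poly_funs"
      "\<And>\<gamma> \<gamma>' t. (\<forall>j. ((\<lambda>s. \<gamma> s $ j) has_field_derivative \<gamma>' $ j) (at t)) \<Longrightarrow>
      ((\<lambda>s. f (\<gamma> s)) has_field_derivative pairing (F (\<gamma> t)) \<gamma>') (at t)"
    and G: "\<And>j. (\<lambda>y. G y $ j) \<in> poly_funs"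
      "\<And>\<gamma> \<gamma>' t. (\<forall>j. ((\<lambda>s. \<gamma> s $ j) has_field_derivative \<gamma>' $ j) (at t)) \<Longrightarrow>
      ((\<lambda>s. g (\<gamma> s)) has_field_derivative pairing (G (\<gamma> t)) \<gamma>') (at t)"
    by blast
  show ?case
  proof (intro exI[of _ "\<lambda>y. F y + G y"] conjI allI impI)
    show "(\<lambda>y. (F y + G y) $ j) \<in> poly_funs" for j
      unfolding vector_add_component by (intro poly_funs.add F(1) G(1))
    fix \<gamma> :: "complex \<Rightarrow> complex ^ 'a" and \<gamma>' t
    assume "\<forall>j. ((\<lambda>s. \<gamma> s $ j) has_field_derivative \<gamma>' $ j) (at t)"
    from DERIV_add[OF F(2)[OF this] G(2)[OF this]]
    show "((\<lambda>s. f (\<gamma> s) + g (\<gamma> s)) has_field_derivative pairing (F (\<gamma> t) + G (\<gamma> t)) \<gamma>') (at t)"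
      by (simp add: pairing_add_left)
  qed
next
  case (mult f g)
  then obtain F G where F: "\<And>j. (\<lambda>y. F y $ j) \<in> poly_funs"
      "\<And>\<gamma> \<gamma>' t. (\<forall>j. ((\<lambda>s. \<gamma> s $ j) has_field_derivative \<gamma>' $ j) (at t)) \<Longrightarrow>
      ((\<lambda>s. f (\<gamma> s)) has_field_derivative pairing (F (\<gamma> t)) \<gamma>') (at t)"
    and G: "\<And>j. (\<lambda>y. G y $ j) \<in> poly_funs"
      "\<And>\<gamma> \<gamma>' t. (\<forall>j. ((\<lambda>s. \<gamma> s $ j) has_field_derivative \<gamma>' $ j) (at t)) \<Longrightarrow>
      ((\<lambda>s. g (\<gamma> s)) has_field_derivative pairing (G (\<gamma> t)) \<gamma>') (at t)"
    by blast
  show ?case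
  proof (intro exI[of _ "\<lambda>y. g y *s F y + f y *s G y"] conjI allI impI)
    show "(\<lambda>y. (g y *s F y + f y *s G y) $ j) \<in> poly_funs" for j
      unfolding vector_add_component vector_smult_component
      by (intro poly_funs.add poly_funs.mult F(1) G(1) mult(1,2))
    fix \<gamma> :: "complex \<Rightarrow> complex ^ 'a" and \<gamma>' t
    assume "\<forall>j. ((\<lambda>s. \<gamma> s $ j) has_field_derivative \<gamma>' $ j) (at t)"
    from DERIV_mult[OF F(2)[OF this] G(2)[OF this]]
    show "((\<lambda>s. f (\<gamma> s) * g (\<gamma> s)) has_field_derivative
        pairing (g (\<gamma> t) *s F (\<gamma> t) + f (\<gamma> t) *s G (\<gamma> t)) \<gamma>') (at t)"
      by (simp add: pairing_add_left pairing_scale_left algebra_simps)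
  qed
qed

lemma line_has_field_derivative:
  "((\<lambda>s. (y + s *s w) $ j) has_field_derivative w $ j) (at t)"
  by (auto intro!: derivative_eq_intros)

lemma
  assumes "f \<in> poly_funs"
  shows poly_funs_chain_rule: "\<And>\<gamma> \<gamma>' t.
      (\<And>j. ((\<lambda>s. \<gamma> s $ j) has_field_derivative \<gamma>' $ j) (at t)) \<Longrightarrow>
      ((\<lambda>s. f (\<gamma> s)) has_field_derivative pairing (grad f (\<gamma> t)) \<gamma>') (at t)"
    and poly_funs_grad: "\<And>j. (\<lambda>y. grad f y $ j) \<in> poly_funs"
proof -
  obtain G where G: "\<And>j. (\<lambda>y. G y $ j) \<in> poly_funs"
      "\<And>\<gamma> \<gamma>' t. (\<And>j. ((\<lambda>s. \<gamma> s $ j) has_field_derivative \<gamma>' $ j) (at t)) \<Longrightarrow>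
      ((\<lambda>s. f (\<gamma> s)) has_field_derivative pairing (G (\<gamma> t)) \<gamma>') (at t)"
    using poly_funs_gradient[OF assms] by blast
  have "grad f y = G y" for y
  proof -
    have "deriv (\<lambda>s. f (y + s *s axis j 1)) 0 = G y $ j" for j
      using DERIV_imp_deriv[OF G(2)[OF line_has_field_derivative[of y "axis j 1" _ 0]]]
      by (simp add: pairing_axis)
    then show ?thesis by (simp add: grad_def vec_eq_iff)
  qed
  with G show "\<And>\<gamma> \<gamma>' t.
      (\<And>j. ((\<lambda>s. \<gamma> s $ j) has_field_derivative \<gamma>' $ j) (at t)) \<Longrightarrow>
      ((\<lambda>s. f (\<gamma> s)) has_field_derivative pairing (grad f (\<gamma> t)) \<gamma>') (at t)"
    "\<And>j. (\<lambda>y. grad f y $ j) \<in> poly_funs"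
    by simp_all
qed

lemma poly_funs_line_derivative:
  assumes "f \<in> poly_funs"
  shows "((\<lambda>s. f (y + s *s w)) has_field_derivative pairing (grad f y) w) (at 0)"
  using poly_funs_chain_rule[OF assms, OF line_has_field_derivative[of y w _ 0]] by simp

lemma grad_eqI:
  assumes "f \<in> poly_funs"
    and "\<And>w. ((\<lambda>s. f (y + s *s w)) has_field_derivative pairing a w) (at 0)"
  shows "grad f y = a"
  using DERIV_unique[OF poly_funs_line_derivative[OF assms(1)] assms(2)]
  by (metis pairing_axis vec_eq_iff)

lemma grad_add:
  assumes "f \<in> poly_funs" "g \<in> poly_funs"
  shows "grad (\<lambda>v. f v + g v) y = grad f y + grad g y"
proof (rule grad_eqI)
  show "(\<lambda>v. f v + g v) \<in> poly_funs" using assms by (rule poly_funs.add)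
  show "((\<lambda>s. f (y + s *s w) + g (y + s *s w)) has_field_derivative
      pairing (grad f y + grad g y) w) (at 0)" for w
    unfolding pairing_add_left by (intro DERIV_add poly_funs_line_derivative assms)
qed

lemma grad_cmul:
  assumes "f \<in> poly_funs"
  shows "grad (\<lambda>v. c * f v) y = c *s grad f y"
proof (rule grad_eqI)
  show "(\<lambda>v. c * f v) \<in> poly_funs" using assms by (rule poly_funs_cmul)
  show "((\<lambda>s. c * f (y + s *s w)) has_field_derivative pairing (c *s grad f y) w) (at 0)" for w
    unfolding pairing_scale_left by (intro DERIV_cmult poly_funs_line_derivative assms)
qed

lemma grad_matrix_subst:
  assumes "f \<in> poly_funs"
  shows "pairing (grad (\<lambda>v. f (A *v v)) y) w = pairing (grad f (A *v y)) (A *v w)"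
proof -
  have "(\<lambda>v. f (A *v v)) \<in> poly_funs"
    by (rule poly_funs_subst[OF assms poly_funs_matrix])
  from poly_funs_line_derivative[OF this, of y w]
  have "((\<lambda>s. f (A *v y + s *s (A *v w))) has_field_derivative pairing (grad (\<lambda>v. f (A *v v)) y) w) (at 0)"
    by (simp add: matrix_vector_right_distrib vec.scale)
  from DERIV_unique[OF this poly_funs_line_derivative[OF assms]] show ?thesis .
qed

text \<open>Hadamard's lemma, for the decomposition \<open>y = (y - B y) + B y\<close>.\<close>

lemma poly_funs_hadamard:
  assumes "f \<in> poly_funs"
  shows "\<exists>H. (\<forall>j. (\<lambda>y. H y $ j) \<in> poly_funs) \<and>
    (\<forall>y. f y - f (y - B *v y) = pairing (H y) (B *v y)) \<and>
    (\<forall>y. B *v y = 0 \<longrightarrow> H y = grad f y)"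
  using assms
proof induction
  case (const c)
  have "grad (\<lambda>_. c) y = 0" for y :: "complex ^ 'a"
    by (intro grad_eqI poly_funs.const) (simp add: pairing_zero_left)
  then show ?case
    by (intro exI[of _ "\<lambda>_. 0"]) (auto simp: pairing_zero_left intro: poly_funs.const)
next
  case (coord i)
  have "grad (\<lambda>v. v $ i) y = axis i 1" for y :: "complex ^ 'a"
    by (intro grad_eqI poly_funs.coord) (auto simp: pairing_axis_left intro!: derivative_eq_intros)
  then show ?case
    by (intro exI[of _ "\<lambda>_. axis i 1"]) (auto simp: pairing_axis_left intro: poly_funs.const)
next
  case (add f g)
  then obtain F G where F: "\<And>j. (\<lambda>y. F y $ j) \<in> poly_funs"
      "\<And>y. f y - f (y - B *v y) = pairing (F y) (B *v y)" "\<And>y. B *v y = 0 \<Longrightarrow> F y = grad f y"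
    and G: "\<And>j. (\<lambda>y. G y $ j) \<in> poly_funs"
      "\<And>y. g y - g (y - B *v y) = pairing (G y) (B *v y)" "\<And>y. B *v y = 0 \<Longrightarrow> G y = grad g y"
    by blast
  show ?case
  proof (intro exI[of _ "\<lambda>y. F y + G y"] conjI allI impI)
    show "(\<lambda>y. (F y + G y) $ j) \<in> poly_funs" for j
      unfolding vector_add_component by (intro poly_funs.add F(1) G(1))
    show "f y + g y - (f (y - B *v y) + g (y - B *v y)) = pairing (F y + G y) (B *v y)" for y
      unfolding pairing_add_left F(2)[symmetric] G(2)[symmetric] by simp
    show "F y + G y = grad (\<lambda>v. f v + g v) y" if "B *v y = 0" for y
      by (simp add: F(3) G(3) that grad_add[OF add(1,2)])
  qed
next
  case (mult f g)
  then obtain F G where F: "\<And>j. (\<lambda>y. F y $ j) \<in> poly_funs"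
      "\<And>y. f y - f (y - B *v y) = pairing (F y) (B *v y)" "\<And>y. B *v y = 0 \<Longrightarrow> F y = grad f y"
    and G: "\<And>j. (\<lambda>y. G y $ j) \<in> poly_funs"
      "\<And>y. g y - g (y - B *v y) = pairing (G y) (B *v y)" "\<And>y. B *v y = 0 \<Longrightarrow> G y = grad g y"
    by blast
  have sub: "(\<lambda>y. g (y - B *v y)) \<in> poly_funs"
  proof (rule poly_funs_subst[OF mult(2)])
    show "(\<lambda>v. (v - B *v v) $ i) \<in> poly_funs" for i
      unfolding vector_minus_component by (intro poly_funs_diff poly_funs.coord poly_funs_matrix)
  qed
  \<comment> \<open>Telescoping: with a prime for the value at \<open>y - B y\<close>, one has
    \<open>f g - f' g' = (f - f') g' + f (g - g')\<close>.\<close>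
  show ?case
  proof (intro exI[of _ "\<lambda>y. g (y - B *v y) *s F y + f y *s G y"] conjI allI impI)
    show "(\<lambda>y. (g (y - B *v y) *s F y + f y *s G y) $ j) \<in> poly_funs" for j
      unfolding vector_add_component vector_smult_component
      by (intro poly_funs.add poly_funs.mult F(1) G(1) mult(1) sub)
    show "f y * g y - f (y - B *v y) * g (y - B *v y)
      = pairing (g (y - B *v y) *s F y + f y *s G y) (B *v y)" for y
      unfolding pairing_add_left pairing_scale_left F(2)[symmetric] G(2)[symmetric]
      by (simp add: algebra_simps)
    show "g (y - B *v y) *s F y + f y *s G y = grad (\<lambda>v. f v * g v) y" if "B *v y = 0" for y
    proof (rule grad_eqI[symmetric])
      show "(\<lambda>v. f v * g v) \<in> poly_funs" using mult by (intro poly_funs.mult)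
      show "((\<lambda>s. f (y + s *s w) * g (y + s *s w)) has_field_derivative
        pairing (g (y - B *v y) *s F y + f y *s G y) w) (at 0)" for w
        using DERIV_mult[OF poly_funs_line_derivative[OF mult(1), of y w]
            poly_funs_line_derivative[OF mult(2), of y w]] that
        by (simp add: F(3) G(3) pairing_add_left pairing_scale_left algebra_simps)
    qed
  qed
qed

section \<open>Vanishing ideals and tangent spaces\<close>

definition vanish_ideal :: "(complex ^ 'n) set \<Rightarrow> (complex ^ 'n \<Rightarrow> complex) set" where
  "vanish_ideal S = {f \<in> poly_funs. \<forall>y\<in>S. f y = 0}"

text \<open>The ideal is not restricted to homogeneous elements, in contrast to
  \<open>cone_tangent_space\<close>; this makes the gradients at \<open>v\<close> a vector
  space.\<close>

definition tangent :: "(complex ^ 'n) set \<Rightarrow> complex ^ 'n \<Rightarrow> (complex ^ 'n) set" where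
  "tangent S v = {w. \<forall>f\<in>vanish_ideal S. pairing (grad f v) w = 0}"

text \<open>A functional that is \<open>1\<close> at \<open>b\<close> and \<open>0\<close> on a
  basis of \<open>W\<close> exists because these vectors are independent; its values on the
  coordinate vectors are the entries of \<open>w\<close>.\<close>

lemma pairing_separation:
  assumes W: "vec.subspace W" and b: "b \<notin> W"
  obtains w where "\<And>x. x \<in> W \<Longrightarrow> pairing x w = 0" "pairing b w \<noteq> 0"
proof -
  obtain B where B: "B \<subseteq> W" "vec.independent B" "W \<subseteq> vec.span B"
    using vec.basis_exists[of W] by metis
  have spanB: "vec.span B = W"
    using vec.span_subspace[OF B(1,3) W] .
  have ind: "vec.independent (insert b B)"
    using vec.independent_insertI[of b B] B(2) b spanB by blast
  interpret vp: vector_space_pair "(*s) :: complex \<Rightarrow> complex ^ 'a \<Rightarrow> _" "(*) :: complex \<Rightarrow> complex \<Rightarrow> complex"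
    by (intro vector_space_pair.intro vec.vector_space_axioms vector_space_over_itself.vector_space_axioms)
  obtain g where g: "Vector_Spaces.linear (*s) (*) g"
    "\<forall>x\<in>insert b B. g x = (if x = b then 1 else 0 :: complex)"
    using vp.linear_independent_extend[OF ind, of "\<lambda>x. if x = b then 1 else 0"] by blast
  define w where "w = (\<chi> j. g (axis j 1))"
  have gp: "g x = pairing x w" for x
  proof -
    have "g x = g (\<Sum>j\<in>UNIV. x $ j *s axis j 1)"
      by (simp add: basis_expansion)
    also have "\<dots> = (\<Sum>j\<in>UNIV. x $ j * g (axis j 1))"
      by (simp add: vp.linear_sum[OF g(1)] vp.linear_scale[OF g(1)])
    finally show ?thesis by (simp add: pairing_def w_def)
  qed
  show ?thesis
  proof
    show "pairing b w \<noteq> 0" using g(2) by (simp add: gp[symmetric])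
    fix x assume "x \<in> W"
    then have "x \<in> vec.span B" using spanB by simp
    moreover have "g y = 0" if "y \<in> B" for y using g(2) that B(1) b by auto
    ultimately have "g x = 0"
      using vp.linear_eq_0_on_span[OF g(1)] by blast
    then show "pairing x w = 0" by (simp add: gp)
  qed
qed

text \<open>The gradients at \<open>v\<close> of elements of the ideal form a subspace whose
  annihilator is the tangent space, so separation puts \<open>b\<close> into it.\<close>

lemma annihilator_tangent:
  assumes "\<And>w. w \<in> tangent S v \<Longrightarrow> pairing b w = 0"
  obtains f where "f \<in> vanish_ideal S" "grad f v = b"
proof -
  let ?W = "(\<lambda>f. grad f v) ` vanish_ideal S"
  have "vec.subspace ?W"
    unfolding vec.subspace_def
  proof (intro conjI ballI allI)
    have "(\<lambda>_. 0) \<in> vanish_ideal S" by (auto simp: vanish_ideal_def intro: poly_funs.const)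
    moreover have "grad (\<lambda>_. 0) v = 0"
      by (intro grad_eqI poly_funs.const) (simp add: pairing_zero_left)
    ultimately show "0 \<in> ?W"
      using image_eqI[where f = "\<lambda>f. grad f v" and x = "\<lambda>_. 0" and b = 0] by simp
  next
    fix a b assume "a \<in> ?W" "b \<in> ?W"
    then obtain f g where fg: "f \<in> vanish_ideal S" "g \<in> vanish_ideal S" "a = grad f v" "b = grad g v"
      by blast
    then have "(\<lambda>v. f v + g v) \<in> vanish_ideal S" by (simp add: vanish_ideal_def poly_funs.add)
    moreover have "grad (\<lambda>v. f v + g v) v = a + b"
      using fg by (simp add: grad_add vanish_ideal_def)
    ultimately show "a + b \<in> ?W"
      using image_eqI[where f = "\<lambda>f. grad f v" and x = "\<lambda>v. f v + g v" and b = "a + b"] by simp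
  next
    fix c a assume "a \<in> ?W"
    then obtain f where fg: "f \<in> vanish_ideal S" "a = grad f v" by blast
    then have "(\<lambda>v. c * f v) \<in> vanish_ideal S" by (simp add: vanish_ideal_def poly_funs_cmul)
    moreover have "grad (\<lambda>v. c * f v) v = c *s a"
      using fg by (simp add: grad_cmul vanish_ideal_def)
    ultimately show "c *s a \<in> ?W"
      using image_eqI[where f = "\<lambda>f. grad f v" and x = "\<lambda>v. c * f v" and b = "c *s a"] by simp
  qed
  have "b \<in> ?W"
  proof (rule ccontr)
    assume "b \<notin> ?W"
    with \<open>vec.subspace ?W\<close> obtain w where "\<And>x. x \<in> ?W \<Longrightarrow> pairing x w = 0" "pairing b w \<noteq> 0"
      using pairing_separation by blast
    then have "w \<in> tangent S v" by (auto simp: tangent_def)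
    with assms \<open>pairing b w \<noteq> 0\<close> show False by blast
  qed
  then show ?thesis using that by blast
qed

section \<open>Gradings and weight components\<close>

lemma poly_eq_off_zero:
  fixes p q :: "complex poly"
  assumes "\<And>t. t \<noteq> 0 \<Longrightarrow> poly p t = poly q t"
  shows "p = q"
proof -
  have "- {0} \<subseteq> {t. poly (p - q) t = 0}" using assms by auto
  moreover have "infinite (- {0 :: complex})"
    by (simp add: infinite_UNIV_char_0 Compl_eq_Diff_UNIV)
  ultimately have "infinite {t. poly (p - q) t = 0}" using infinite_super by blast
  then have "p - q = 0" using poly_roots_finite by blast
  then show ?thesis by simp
qed

text \<open>Multiplied by a large power of \<open>t\<close>, the sum becomes a polynomial with
  infinitely many zeros. Weight components are extracted in this way throughout.\<close>

lemma laurent_coeffs_zero: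
  fixes a :: "int \<Rightarrow> complex"
  assumes fin: "finite J" and z: "\<And>t. t \<noteq> 0 \<Longrightarrow> (\<Sum>k\<in>J. t powi k * a k) = 0" and k: "k \<in> J"
  shows "a k = 0"
proof -
  define M where "M = (\<Sum>k\<in>J. \<bar>k\<bar>)"
  have M: "0 \<le> M + j" if "j \<in> J" for j
    using member_le_sum[of j J abs] that fin by (auto simp: M_def)
  define p where "p = (\<Sum>j\<in>J. monom (a j) (nat (M + j)))"
  have "poly p t = poly 0 t" if "t \<noteq> 0" for t
  proof -
    have "poly p t = (\<Sum>j\<in>J. t powi M * (t powi j * a j))"
      unfolding p_def poly_sum
    proof (rule sum.cong)
      fix j assume "j \<in> J"
      then show "poly (monom (a j) (nat (M + j))) t = t powi M * (t powi j * a j)"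
        using M[of j] that by (simp add: poly_monom power_int_add[symmetric] mult.assoc[symmetric] power_int_def[of t "M + j"])
    qed simp
    also have "\<dots> = 0" using z[OF that] by (simp add: sum_distrib_left[symmetric])
    finally show ?thesis by simp
  qed
  then have "p = 0" by (rule poly_eq_off_zero)
  moreover have "coeff p (nat (M + k)) = (\<Sum>j\<in>J. if j = k then a j else 0)"
    unfolding p_def coeff_sum using M k by (intro sum.cong) (auto simp: nat_eq_iff)
  ultimately show ?thesis using fin k by simp
qed

lemma laurent_coeffs_zero_vec:
  fixes a :: "int \<Rightarrow> complex ^ 'n"
  assumes fin: "finite J" and z: "\<And>t. t \<noteq> 0 \<Longrightarrow> (\<Sum>k\<in>J. t powi k *s a k) = 0" and k: "k \<in> J"
  shows "a k = 0"
proof -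
  have "a k $ i = 0" for i
  proof (rule laurent_coeffs_zero[OF fin _ k])
    show "(\<Sum>k\<in>J. t powi k * a k $ i) = 0" if "t \<noteq> 0" for t
      using arg_cong[OF z[OF that], of "\<lambda>x. x $ i"] by simp
  qed
  then show ?thesis by (simp add: vec_eq_iff)
qed

lemma power_times_shifted_power:
  fixes t :: complex
  assumes "t \<noteq> 0" "int c \<le> j"
  shows "t ^ c * (x * t ^ nat (j - int c)) = t powi j * x"
proof -
  have "t ^ c * t ^ nat (j - int c) = t powi j"
    using assms by (simp add: power_int_def power_add[symmetric] algebra_simps nat_diff_distrib)
  then show ?thesis by (metis mult.assoc mult.commute)
qed

lemma sum_matrix_mult: "(\<Sum>k\<in>D. C k) *v w = (\<Sum>k\<in>D. C k *v (w :: complex ^ 'n))"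
  by (induction D rule: infinite_finite_induct) (auto simp: matrix_vector_mult_add_rdistrib)

text \<open>The weight spaces of a torus action, given by their projections. As \<open>P\<close> is
  defined on all integers and is \<open>0\<close> off the finite set \<open>K\<close>, components
  can be compared in every integer weight.\<close>

locale grading =
  fixes K :: "int set" and P :: "int \<Rightarrow> complex ^ 'n ^ 'n"
  assumes finite_K: "finite K"
    and P_outside: "\<And>k. k \<notin> K \<Longrightarrow> P k = 0"
    and P_mult: "\<And>j k. P j ** P k = (if j = k then P k else 0)"
    and P_sum: "(\<Sum>k\<in>K. P k) = mat 1"
begin

lemma P_P: "P j *v (P k *v y) = (if j = k then P k *v y else 0)"
  by (simp add: matrix_vector_mul_assoc P_mult)

lemma P_zero: "P k *v y \<noteq> 0 \<Longrightarrow> k \<in> K"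
  using P_outside by force

lemma sum_P: "(\<Sum>k\<in>K. P k *v y) = y"
  by (simp add: P_sum flip: sum_matrix_mult)

lemma P_ext:
  assumes "\<And>k. P k *v y = P k *v z"
  shows "y = z"
proof -
  have "(\<Sum>k\<in>K. P k *v y) = (\<Sum>k\<in>K. P k *v z)" by (simp only: assms)
  then show ?thesis unfolding sum_P .
qed

definition act :: "complex \<Rightarrow> complex ^ 'n \<Rightarrow> complex ^ 'n" where
  "act t y = (\<Sum>k\<in>K. t powi k *s (P k *v y))"

lemma P_sum_graded: "P k *v (\<Sum>j\<in>J. a j *s (P j *v y)) = (if k \<in> J \<and> finite J then a k *s (P k *v y) else 0)"
  by (induction J rule: infinite_finite_induct)
    (auto simp: matrix_vector_right_distrib vec.scale P_P)

lemma P_act: "P k *v act t y = t powi k *s (P k *v y)"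
  unfolding act_def P_sum_graded using finite_K P_zero[of k y] by auto

lemma act_act: "s \<noteq> 0 \<Longrightarrow> t \<noteq> 0 \<Longrightarrow> act s (act t y) = act (s * t) y"
  by (rule P_ext) (simp add: P_act power_int_mult_distrib)

lemma act_1: "act 1 y = y"
  by (rule P_ext) (simp add: P_act)

lemma act_linear: "Vector_Spaces.linear (*s) (*s) (act t)"
  by unfold_locales
    (auto simp: act_def matrix_vector_right_distrib vec.scale sum.distrib vector_add_ldistrib
      vec.scale_sum_right mult.commute)

lemma act_matrix: "matrix (act t) *v y = act t y"
  using matrix_works[OF act_linear] .

lemma act_add: "act t (y + z) = act t y + act t z"
  by (metis act_matrix matrix_vector_right_distrib)

lemma act_scale: "act t (c *s y) = c *s act t y"
  by (metis act_matrix vec.scale)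

lemma P_fixed: "P 0 *v v = v \<Longrightarrow> P k *v v = (if k = 0 then v else 0)"
  using P_P[of k 0 v] by simp

lemma act_fixed: "P 0 *v v = v \<Longrightarrow> act t v = v"
  by (rule P_ext) (simp add: P_act P_fixed)

text \<open>Along the action \<open>f\<close> is a Laurent polynomial in \<open>t\<close> with
  coefficients polynomial in \<open>y\<close>. That the coefficients have pure weight is derived
  separately, from their uniqueness.\<close>

lemma weight_components:
  assumes "f \<in> poly_funs"
  shows "\<exists>J F. finite J \<and> (\<forall>k. F k \<in> poly_funs) \<and>
    (\<forall>t y. t \<noteq> 0 \<longrightarrow> f (act t y) = (\<Sum>k\<in>J. t powi k * F k y))"
  using assms
proof induction
  case (const c)
  show ?case
    by (intro exI[of _ "{0}"] exI[of _ "\<lambda>_ _. c"]) (auto intro: poly_funs.const)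
next
  case (coord i)
  show ?case
    by (intro exI[of _ K] exI[of _ "\<lambda>k y. (P k *v y) $ i"])
      (auto simp: finite_K act_def intro: poly_funs_matrix)
next
  case (add f g)
  then obtain J F J' G where
    F: "finite J" "\<And>k. F k \<in> poly_funs" "\<And>t y. t \<noteq> 0 \<Longrightarrow> f (act t y) = (\<Sum>k\<in>J. t powi k * F k y)"
    and G: "finite J'" "\<And>k. G k \<in> poly_funs" "\<And>t y. t \<noteq> 0 \<Longrightarrow> g (act t y) = (\<Sum>k\<in>J'. t powi k * G k y)"
    by blast
  \<comment> \<open>The families \<open>F\<close> and \<open>G\<close> are unconstrained off
    \<open>J\<close> and \<open>J'\<close>, so each is cut off before adding.\<close>
  define H where "H k y = (if k \<in> J then 1 else 0) * F k y + (if k \<in> J' then 1 else 0) * G k y" for k y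
  show ?case
  proof (intro exI[of _ "J \<union> J'"] exI[of _ H] conjI allI impI)
    show "finite (J \<union> J')" using F G by simp
    show "H k \<in> poly_funs" for k
      unfolding H_def by (intro poly_funs.add poly_funs_cmul F G)
    fix t y assume "(t::complex) \<noteq> 0"
    have "(\<Sum>k\<in>J \<union> J'. t powi k * H k y) =
        (\<Sum>k\<in>J \<union> J'. if k \<in> J then t powi k * F k y else 0) +
        (\<Sum>k\<in>J \<union> J'. if k \<in> J' then t powi k * G k y else 0)"
      unfolding sum.distrib[symmetric] by (intro sum.cong) (auto simp: H_def algebra_simps)
    also have "\<dots> = (\<Sum>k\<in>J. t powi k * F k y) + (\<Sum>k\<in>J'. t powi k * G k y)"
      using F(1) G(1) by (auto simp: sum.inter_restrict[symmetric] Int_absorb1 Int_commute)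
    finally show "f (act t y) + g (act t y) = (\<Sum>k\<in>J \<union> J'. t powi k * H k y)"
      using F(3) G(3) \<open>t \<noteq> 0\<close> by simp
  qed
next
  case (mult f g)
  then obtain J F J' G where
    F: "finite J" "\<And>k. F k \<in> poly_funs" "\<And>t y. t \<noteq> 0 \<Longrightarrow> f (act t y) = (\<Sum>k\<in>J. t powi k * F k y)"
    and G: "finite J'" "\<And>k. G k \<in> poly_funs" "\<And>t y. t \<noteq> 0 \<Longrightarrow> g (act t y) = (\<Sum>k\<in>J'. t powi k * G k y)"
    by blast
  let ?s = "\<lambda>p. fst p + snd p :: int"
  define H where "H k y = (\<Sum>p\<in>{p \<in> J \<times> J'. ?s p = k}. F (fst p) y * G (snd p) y)" for k y
  show ?case
  proof (intro exI[of _ "?s ` (J \<times> J')"] exI[of _ H] conjI allI impI)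
    show "finite (?s ` (J \<times> J'))" using F G by simp
    show "H k \<in> poly_funs" for k
      unfolding H_def by (intro poly_funs_sum poly_funs.mult F G)
    fix t y assume t: "(t::complex) \<noteq> 0"
    have "(\<Sum>k\<in>?s ` (J \<times> J'). t powi k * H k y) =
        (\<Sum>k\<in>?s ` (J \<times> J'). \<Sum>p\<in>{p \<in> J \<times> J'. ?s p = k}. t powi (?s p) * (F (fst p) y * G (snd p) y))"
      by (intro sum.cong) (auto simp: H_def sum_distrib_left)
    also have "\<dots> = (\<Sum>p\<in>J \<times> J'. t powi (?s p) * (F (fst p) y * G (snd p) y))"
      using F(1) G(1) by (intro sum.group) auto
    also have "\<dots> = (\<Sum>p\<in>J \<times> J'. (t powi fst p * F (fst p) y) * (t powi snd p * G (snd p) y))"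
      using t by (intro sum.cong) (auto simp: power_int_add algebra_simps)
    also have "\<dots> = (\<Sum>k\<in>J. t powi k * F k y) * (\<Sum>k\<in>J'. t powi k * G k y)"
      by (simp add: sum_product sum.cartesian_product case_prod_beta)
    finally show "f (act t y) * g (act t y) = (\<Sum>k\<in>?s ` (J \<times> J'). t powi k * H k y)"
      using F(3) G(3) t by simp
  qed
qed

text \<open>Compare the coefficients of the powers of \<open>s\<close> in two expansions of
  \<open>f (act (s * t) y)\<close>.\<close>

lemma weight_components_homogeneous:
  assumes J: "finite J"
    and F: "\<And>t y. t \<noteq> 0 \<Longrightarrow> f (act t y) = (\<Sum>k\<in>J. t powi k * F k y)"
    and t: "t \<noteq> 0" and k: "k \<in> J"
  shows "F k (act t y) = t powi k * F k y"
proof -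
  have "F k (act t y) - t powi k * F k y = 0"
  proof (rule laurent_coeffs_zero[OF J _ k, of "\<lambda>k. F k (act t y) - t powi k * F k y"])
    fix s :: complex assume s: "s \<noteq> 0"
    have "(\<Sum>k\<in>J. s powi k * F k (act t y)) = (\<Sum>k\<in>J. (s * t) powi k * F k y)"
      using s t by (simp add: F[symmetric] act_act)
    then show "(\<Sum>k\<in>J. s powi k * (F k (act t y) - t powi k * F k y)) = 0"
      by (simp add: algebra_simps sum_subtractf power_int_mult_distrib)
  qed
  then show ?thesis by simp
qed

text \<open>The weight \<open>k\<close> component of \<open>f\<close> serves: it lies in the ideal
  because \<open>S\<close> is stable under the action, and it keeps the whole gradient at the fixed
  vector \<open>v\<close> because that gradient has weight \<open>k\<close>.\<close>

lemma weight_component_exists: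
  assumes f: "f \<in> vanish_ideal S" and S: "\<And>t y. t \<noteq> 0 \<Longrightarrow> y \<in> S \<Longrightarrow> act t y \<in> S"
    and v: "P 0 *v v = v"
    and k: "\<And>w. pairing (grad f v) (P k *v w) = pairing (grad f v) w"
  obtains g where "g \<in> vanish_ideal S" "\<And>t y. t \<noteq> 0 \<Longrightarrow> g (act t y) = t powi k * g y"
    "grad g v = grad f v"
proof -
  have fp: "f \<in> poly_funs" using f by (simp add: vanish_ideal_def)
  then obtain J0 F0 where J0: "finite J0" "\<And>k. F0 k \<in> poly_funs"
    "\<And>t y. t \<noteq> 0 \<Longrightarrow> f (act t y) = (\<Sum>k\<in>J0. t powi k * F0 k y)"
    using weight_components by blast
  \<comment> \<open>\<open>k\<close> may be missing from \<open>J0\<close>; it is added with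
    component zero, so that coefficients can be compared at \<open>k\<close>.\<close>
  define J where "J = insert k J0"
  define F where "F k y = (if k \<in> J0 then 1 else 0) * F0 k y" for k y
  have J: "finite J" "k \<in> J" using J0 by (auto simp: J_def)
  have FP: "F k \<in> poly_funs" for k unfolding F_def by (intro poly_funs_cmul J0)
  have F: "f (act t y) = (\<Sum>k\<in>J. t powi k * F k y)" if "t \<noteq> 0" for t y
  proof -
    have "(\<Sum>k\<in>J. t powi k * F k y) = (\<Sum>k\<in>J0. t powi k * F k y)"
      using J0(1) by (intro sum.mono_neutral_right) (auto simp: J_def F_def)
    also have "\<dots> = (\<Sum>k\<in>J0. t powi k * F0 k y)" by (intro sum.cong) (auto simp: F_def)
    finally show ?thesis using J0(3) that by simp
  qed
  have deriv: "pairing (grad f v) (act t w) = (\<Sum>k\<in>J. t powi k * pairing (grad (F k) v) w)"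
    if "t \<noteq> 0" for t w
  proof -
    have "((\<lambda>s. f (v + s *s act t w)) has_field_derivative pairing (grad f v) (act t w)) (at 0)"
      by (rule poly_funs_line_derivative[OF fp])
    moreover have "f (v + s *s act t w) = (\<Sum>k\<in>J. t powi k * F k (v + s *s w))" for s
      using F[OF that, of "v + s *s w"] by (simp add: act_add act_scale act_fixed v)
    moreover have "((\<lambda>s. \<Sum>k\<in>J. t powi k * F k (v + s *s w)) has_field_derivative
        (\<Sum>k\<in>J. t powi k * pairing (grad (F k) v) w)) (at 0)"
      by (intro DERIV_sum DERIV_cmult poly_funs_line_derivative FP)
    ultimately show ?thesis using DERIV_unique by simp
  qed
  have act: "pairing (grad f v) (act t w) = t powi k * pairing (grad f v) w" for t w
    using k[of "act t w"] k[of w] by (simp add: P_act pairing_scale_right)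
  have "pairing (grad (F k) v) w = pairing (grad f v) w" for w
  proof -
    \<comment> \<open>The condition \<open>k = k\<close> is what the coefficient family given below
      becomes at \<open>j = k\<close>.\<close>
    have "pairing (grad (F k) v) w - (if k = k then pairing (grad f v) w else 0) = 0"
    proof (rule laurent_coeffs_zero[OF J(1) _ J(2),
        of "\<lambda>j. pairing (grad (F j) v) w - (if j = k then pairing (grad f v) w else 0)"])
      fix t :: complex assume t: "t \<noteq> 0"
      have "(\<Sum>j\<in>J. t powi j * (pairing (grad (F j) v) w - (if j = k then pairing (grad f v) w else 0)))
        = (\<Sum>j\<in>J. t powi j * pairing (grad (F j) v) w) - (\<Sum>j\<in>J. if j = k then t powi j * pairing (grad f v) w else 0)"
        unfolding sum_subtractf[symmetric] by (intro sum.cong) (auto simp: algebra_simps)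
      also have "\<dots> = 0" using J by (simp add: deriv[OF t, symmetric] act)
      finally show "(\<Sum>j\<in>J. t powi j * (pairing (grad (F j) v) w - (if j = k then pairing (grad f v) w else 0))) = 0" .
    qed
    then show ?thesis by simp
  qed
  then have "grad (F k) v = grad f v" by (metis pairing_axis vec_eq_iff)
  moreover have "F k \<in> vanish_ideal S"
  proof -
    have "F k y = 0" if "y \<in> S" for y
    proof (rule laurent_coeffs_zero[OF J(1) _ J(2), of "\<lambda>k. F k y"])
      fix t :: complex assume t: "t \<noteq> 0"
      have "f (act t y) = 0" using f S[OF t that] by (simp add: vanish_ideal_def)
      then show "(\<Sum>k\<in>J. t powi k * F k y) = 0" by (simp only: F[OF t])
    qed
    then show ?thesis using FP by (simp add: vanish_ideal_def)
  qed
  ultimately show ?thesis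
    using weight_components_homogeneous[OF J(1) F _ J(2)] that by blast
qed

text \<open>On the curve \<open>act t z\<close>, which is \<open>a\<close> plus terms divisible by
  \<open>t ^ c\<close>, the function equals \<open>t powi k * g z\<close> and is itself divisible by
  \<open>t ^ c\<close>. Since \<open>k < c\<close>, cancelling \<open>t powi k\<close> and putting
  \<open>t = 0\<close> gives the claim.\<close>

lemma weight_vanishing:
  assumes g: "g \<in> poly_funs" "\<And>t y. t \<noteq> 0 \<Longrightarrow> g (act t y) = t powi k * g y"
    and k: "k < int c"
    and z: "\<And>t. t \<noteq> 0 \<Longrightarrow> act t z = a + (\<Sum>j\<in>{j\<in>K. int c \<le> j}. t powi j *s (P j *v z))"
    and a: "c = 0 \<or> g a = 0"
  shows "g z = 0"
proof -
  let ?p = "\<lambda>i. \<Sum>j\<in>{j\<in>K. int c \<le> j}. monom ((P j *v z) $ i) (nat (j - int c))"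
  have "\<exists>q. \<forall>t. g (\<chi> i. a $ i + t ^ c * poly (?p i) t) = g a + t ^ c * poly q t"
    by (rule poly_funs_along_curve[OF g(1), of _ _ _ ?p]) simp
  then obtain q where q: "\<And>t. g (\<chi> i. a $ i + t ^ c * poly (?p i) t) = g a + t ^ c * poly q t"
    by blast
  \<comment> \<open>For \<open>c = 0\<close> the constant \<open>g a\<close> is absorbed into the
    quotient; otherwise it is zero.\<close>
  define r where "r = (if c = 0 then q + [:g a:] else q)"
  have r: "g a + t ^ c * poly q t = t ^ c * poly r t" for t
    using a by (auto simp: r_def)
  have curve: "(\<chi> i. a $ i + t ^ c * poly (?p i) t) = act t z" if "t \<noteq> 0" for t
  proof -
    show ?thesis
      by (auto simp: vec_eq_iff z[OF that] power_times_shifted_power[OF that] poly_sum poly_monom sum_distrib_left intro!: sum.cong)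
  qed
  have "poly [:g z:] t = poly (monom 1 (nat (int c - k)) * r) t" if t: "t \<noteq> 0" for t
  proof -
    have "t powi k * g z = t ^ c * poly r t"
      using q[of t] curve[OF t] g(2)[OF t] r by simp
    also have "t ^ c = t powi k * t ^ nat (int c - k)"
      using t k by (simp flip: power_int_of_nat add: power_int_add[symmetric])
    finally show ?thesis using t by (simp add: poly_monom)
  qed
  then have "[:g z:] = monom 1 (nat (int c - k)) * r" by (rule poly_eq_off_zero)
  then have "poly [:g z:] 0 = poly (monom 1 (nat (int c - k)) * r) 0" by simp
  then show ?thesis using k by (simp add: poly_monom)
qed

end

section \<open>Irreducible cones\<close>

text \<open>Primality is stated for homogeneous polynomials, as this is what irreducibility in
  projective space expresses directly.\<close>

locale irreducible_cone =
  fixes S :: "(complex ^ 'n) set"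
  assumes scale: "\<And>c y. y \<in> S \<Longrightarrow> c *s y \<in> S"
    and closed: "\<And>y. (\<And>f. f \<in> vanish_ideal S \<Longrightarrow> f y = 0) \<Longrightarrow> y \<in> S"
    and prime: "\<And>f g. \<lbrakk>f \<in> homogeneous_polys; g \<in> homogeneous_polys; \<forall>y\<in>S. f y * g y = 0\<rbrakk>
      \<Longrightarrow> (\<forall>y\<in>S. f y = 0) \<or> (\<forall>y\<in>S. g y = 0)"
begin

text \<open>As \<open>S\<close> is a cone and \<open>g\<close> is homogeneous, \<open>g\<close>
  times each homogeneous component of \<open>f\<close> vanishes on \<open>S\<close>; a component
  that is nonzero at \<open>v\<close> is fed into \<open>prime\<close>. The intended
  \<open>f\<close> is a determinant.\<close>

lemma prime_inhomogeneous:
  assumes f: "f \<in> poly_funs" and g: "g \<in> homogeneous_polys"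
    and fg: "\<And>y. y \<in> S \<Longrightarrow> f y * g y = 0" and v: "v \<in> S" "f v \<noteq> 0" and y: "y \<in> S"
  shows "g y = 0"
proof -
  \<comment> \<open>All of \<open>V\<close> gets weight \<open>1\<close>, so weight components are
    components of the usual degree.\<close>
  interpret h: grading "{1}" "\<lambda>k. if k = 1 then mat 1 :: complex ^ 'n ^ 'n else 0"
    by unfold_locales auto
  have act: "h.act t y = t *s y" for t y by (simp add: h.act_def)
  obtain J F where F: "finite J" "\<And>k. F k \<in> poly_funs"
    "\<And>t y. t \<noteq> 0 \<Longrightarrow> f (t *s y) = (\<Sum>k\<in>J. t powi k * F k y)"
    using h.weight_components[OF f] unfolding act by metis
  obtain k where k: "k \<in> J" "F k v \<noteq> 0"
    using F(3)[of 1 v] v(2) by (auto elim: sum.not_neutral_contains_not_neutral)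
  have weight: "F k (t *s y) = t powi k * F k y" if "t \<noteq> 0" for t y
    using h.weight_components_homogeneous[OF F(1) _ that k(1)] F(3) unfolding act by metis
  \<comment> \<open>A negative degree would force \<open>F k v = 0\<close>, by
    \<open>weight_vanishing\<close> with \<open>c = 0\<close>.\<close>
  have "0 \<le> k"
  proof (rule ccontr)
    assume "\<not> 0 \<le> k"
    have "{j. j = (1::int) \<and> 0 \<le> j} = {1}" by auto
    then have "F k v = 0"
      using h.weight_vanishing[OF F(2), of k k 0 v 0] weight \<open>\<not> 0 \<le> k\<close>
      by (simp add: act)
    with k show False by simp
  qed
  then obtain d where d: "k = int d" using zero_le_imp_eq_int by blast
  \<comment> \<open>So far this is known for \<open>t \<noteq> 0\<close>; both sides are polynomial
    in \<open>t\<close>, so it extends to \<open>t = 0\<close>.\<close>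
  have "F k (t *s y) = t ^ d * F k y" for t y
  proof -
    have "\<exists>q. \<forall>t. F k (t *s y) = F k 0 + t ^ 0 * poly q t"
      by (rule poly_funs_along_curve[OF F(2), of _ _ _ "\<lambda>i. [:0, y $ i:]"]) simp
    then obtain q where q: "\<And>t. F k (t *s y) = F k 0 + poly q t" by auto
    have "[:F k 0:] + q = monom (F k y) d"
    proof (rule poly_eq_off_zero)
      fix t :: complex assume "t \<noteq> 0"
      then have "F k 0 + poly q t = t powi k * F k y" using q weight by metis
      then show "poly ([:F k 0:] + q) t = poly (monom (F k y) d) t"
        by (simp add: d poly_monom mult.commute)
    qed
    then have "poly ([:F k 0:] + q) t = poly (monom (F k y) d) t" by simp
    then show ?thesis by (simp add: q poly_monom mult.commute)
  qed
  then have "F k \<in> homogeneous_polys" using F(2) by (auto simp: homogeneous_polys_def)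
  moreover have "F k y * g y = 0" if "y \<in> S" for y
  proof (rule laurent_coeffs_zero[OF F(1) _ k(1), of "\<lambda>k. F k y * g y"])
    fix t :: complex assume t: "t \<noteq> 0"
    obtain e where "g (t *s y) = t ^ e * g y" using g by (auto simp: homogeneous_polys_def)
    then have "f (t *s y) * g y = 0" using fg[OF scale[OF that, of t]] t by simp
    then show "(\<Sum>k\<in>J. t powi k * (F k y * g y)) = 0"
      using F(3)[OF t] by (simp add: sum_distrib_right mult.assoc)
  qed
  ultimately show ?thesis using prime[of "F k" g] g k(2) v(1) y by blast
qed

end

section \<open>Weights on a cone with a torus action\<close>

lemma pairing_row: "pairing (A $ i) w = (A *v w) $ i"
  by (simp add: pairing_def matrix_vector_mult_def)

lemma homogeneous_polys_matrix: "(\<lambda>v. (A *v v) $ i) \<in> homogeneous_polys"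
  by (auto simp: homogeneous_polys_def poly_funs_matrix vec.scale intro!: exI[of _ 1])

locale graded_cone = irreducible_cone S + grading K P
  for S :: "(complex ^ 'n) set" and K and P :: "int \<Rightarrow> complex ^ 'n ^ 'n" +
  assumes act_S: "\<And>t y. t \<noteq> 0 \<Longrightarrow> y \<in> S \<Longrightarrow> act t y \<in> S"
begin

text \<open>A form of Nakayama's lemma: the coordinates \<open>B y\<close> generate an ideal \<open>\<bb>\<close> of the local ring
  at \<open>v\<close> with \<open>\<bb> = \<mm> \<bb>\<close>, the relations being given by a matrix \<open>a\<close> with \<open>a(v) = 1\<close>.\<close>

lemma projection_vanishes:
  assumes v: "v \<in> S" "P 0 *v v = v"
    and C: "\<And>k w. k \<in> D \<Longrightarrow> C k *v (P k *v w) = C k *v w"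
    and B: "B = (\<Sum>k\<in>D. C k)" "\<And>y. B *v (B *v y) = B *v y" "B *v v = 0"
    and tan: "\<And>k w. k \<in> D \<Longrightarrow> w \<in> tangent S v \<Longrightarrow> C k *v w = 0"
    and van: "\<And>k g y. \<lbrakk>k \<in> D; g \<in> vanish_ideal S; \<And>t y. t \<noteq> 0 \<Longrightarrow> g (act t y) = t powi k * g y; y \<in> S\<rbrakk>
      \<Longrightarrow> g (y - B *v y) = 0"
    and y: "y \<in> S"
  shows "B *v y = 0"
proof -
  \<comment> \<open>The row \<open>C k $ i\<close> kills the tangent space, so it is the gradient of
    an element of the ideal, which may be taken of weight \<open>k\<close>. Its Hadamard expansion
    is a relation between the coordinates of \<open>B y\<close>, because \<open>van\<close> removes
    the value at \<open>y - B y\<close>.\<close>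
  have "\<exists>H. (\<forall>j. (\<lambda>y. H y $ j) \<in> poly_funs) \<and> (\<forall>y\<in>S. pairing (H y) (B *v y) = 0) \<and> H v = C k $ i"
    if k: "k \<in> D" for k i
  proof -
    obtain f where f: "f \<in> vanish_ideal S" "grad f v = C k $ i"
      by (rule annihilator_tangent[of S v "C k $ i"]) (auto simp: pairing_row tan k)
    obtain g where g: "g \<in> vanish_ideal S" "\<And>t y. t \<noteq> 0 \<Longrightarrow> g (act t y) = t powi k * g y"
        "grad g v = C k $ i"
      by (rule weight_component_exists[OF f(1) act_S v(2), of k]) (auto simp: f pairing_row C k)
    have "g \<in> poly_funs" using g(1) by (simp add: vanish_ideal_def)
    then obtain H where H: "\<And>j. (\<lambda>y. H y $ j) \<in> poly_funs"
        "\<And>y. g y - g (y - B *v y) = pairing (H y) (B *v y)" "\<And>y. B *v y = 0 \<Longrightarrow> H y = grad g y"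
      using poly_funs_hadamard[of g B] by blast
    have "pairing (H y) (B *v y) = 0" if "y \<in> S" for y
      using H(2)[of y] van[OF k g(1,2) that] g(1) that by (simp add: vanish_ideal_def)
    then show ?thesis using H(1) H(3)[OF B(3)] g(3) by metis
  qed
  then obtain H where H: "\<And>k i j. k \<in> D \<Longrightarrow> (\<lambda>y. H k i y $ j) \<in> poly_funs"
    "\<And>k i y. k \<in> D \<Longrightarrow> y \<in> S \<Longrightarrow> pairing (H k i y) (B *v y) = 0"
    "\<And>k i. k \<in> D \<Longrightarrow> H k i v = C k $ i"
    by metis
  \<comment> \<open>The relations sum to \<open>B\<close> at \<open>v\<close>; adding
    \<open>mat 1 - B\<close>, which kills \<open>B y\<close>, makes the matrix the identity
    there.\<close>
  define a where "a y = (\<chi> i. \<Sum>k\<in>D. H k i y) + (mat 1 - B)" for y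
  have Hmult: "(\<chi> i. \<Sum>k\<in>D. H k i y) *v w = (\<chi> i. \<Sum>k\<in>D. pairing (H k i y) w)" for y w
    by (simp add: vec_eq_iff pairing_def matrix_vector_mult_def sum_distrib_right sum.swap[of _ UNIV])
  have av: "a v = mat 1"
    by (simp add: a_def vec_eq_iff H(3) B(1))
  have aB: "a y *v (B *v y) = 0" if "y \<in> S" for y
    using that H(2)
    by (simp add: a_def matrix_vector_mult_add_rdistrib matrix_vector_mult_diff_rdistrib B(2) Hmult vec_eq_iff)
  \<comment> \<open>Where the determinant is nonzero, \<open>a y\<close> killing \<open>B y\<close>
    forces \<open>B y = 0\<close>. The determinant is \<open>1\<close> at \<open>v\<close>, and
    irreducibility spreads the vanishing to all of \<open>S\<close>.\<close>
  have "(B *v y) $ i = 0" for i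
  proof (rule prime_inhomogeneous[of "\<lambda>y. det (a y)" "\<lambda>y. (B *v y) $ i", OF _ _ _ v(1) _ y])
    show "(\<lambda>y. det (a y)) \<in> poly_funs"
    proof (rule poly_funs_det)
      fix i j
      have "(\<lambda>y. (\<Sum>k\<in>D. H k i y $ j) + (mat 1 - B) $ i $ j) \<in> poly_funs"
        by (intro poly_funs.add poly_funs.const poly_funs_sum H)
      then show "(\<lambda>y. a y $ i $ j) \<in> poly_funs" by (simp add: a_def)
    qed
    show "(\<lambda>y. (B *v y) $ i) \<in> homogeneous_polys" by (rule homogeneous_polys_matrix)
    show "det (a v) \<noteq> 0" by (simp add: av)
    fix y assume yS: "y \<in> S"
    show "det (a y) * (B *v y) $ i = 0"
    proof (cases "det (a y) = 0")
      case False
      then have "invertible (a y)" by (simp add: invertible_det_nz)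
      then obtain A where "A ** a y = mat 1" by (auto simp: invertible_def)
      then have "B *v y = A *v (a y *v (B *v y))" by (metis matrix_vector_mul_assoc matrix_vector_mul_lid)
      then show ?thesis using aB[OF yS] by simp
    qed simp
  qed
  then show ?thesis by (simp add: vec_eq_iff)
qed

end

lemma rank_one_matrix:
  obtains Q where "\<And>w. Q *v w = pairing l (A *v w) *s v"
proof
  show "matrix (\<lambda>w. pairing l (A *v w) *s v) *v w = pairing l (A *v w) *s v" for w
    by (rule matrix_works, unfold_locales)
      (auto simp: matrix_vector_right_distrib vec.scale pairing_add_right pairing_scale_right
        vec.scale_left_distrib)
qed

context grading
begin

lemma P_sum_set: "finite D \<Longrightarrow> P j *v (\<Sum>k\<in>D. P k *v w) = (if j \<in> D then P j *v w else 0)"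
  using P_sum_graded[where k = j and J = D and a = "\<lambda>_. 1" and y = w] by simp

text \<open>Puts \<open>act t z\<close> into the shape required by \<open>weight_vanishing\<close>
  when \<open>z\<close> agrees with a fixed vector \<open>a\<close> in weights below
  \<open>c\<close>.\<close>

lemma act_eq_sum_ge:
  assumes "\<And>j. j < int c \<Longrightarrow> P j *v z = P j *v a" "\<And>j. int c \<le> j \<Longrightarrow> P j *v a = 0" "\<And>t. act t a = a"
  shows "act t z = a + (\<Sum>j\<in>{j\<in>K. int c \<le> j}. t powi j *s (P j *v z))"
proof (rule P_ext)
  fix k
  have "P k *v a = t powi k *s (P k *v a)" using assms(3)[of t] P_act by metis
  then show "P k *v act t z = P k *v (a + (\<Sum>j\<in>{j\<in>K. int c \<le> j}. t powi j *s (P j *v z)))"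
    using assms(1,2)[of k] finite_K P_outside[of k]
    by (cases "k \<in> K"; cases "k < int c") (auto simp: P_act matrix_vector_right_distrib P_sum_graded)
qed

end

context graded_cone
begin

text \<open>Let \<open>B\<close> project onto the negative weights. A function of negative weight
  vanishes at every vector with nonnegative weights only, such as \<open>y - B y\<close>, so
  \<open>projection_vanishes\<close> applies.\<close>

lemma no_negative_weights:
  assumes v: "v \<in> S" "P 0 *v v = v"
    and tan: "\<And>w. w \<in> tangent S v \<Longrightarrow> P 0 *v w = w"
    and y: "y \<in> S" and k: "k < 0"
  shows "P k *v y = 0"
proof -
  let ?D = "{k\<in>K. k < 0}" and ?B = "\<Sum>k\<in>{k\<in>K. k < 0}. P k"
  have fin: "finite ?D" using finite_K by simp
  have PB: "P j *v (?B *v w) = (if j \<in> ?D then P j *v w else 0)" for j w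
    unfolding sum_matrix_mult by (rule P_sum_set[OF fin])
  have "?B *v y = 0"
  proof (rule projection_vanishes[OF v _ refl _ _ _ _ y])
    show "P k *v (P k *v w) = P k *v w" for k w by (simp add: P_P)
    show "?B *v (?B *v y) = ?B *v y" for y by (rule P_ext) (simp add: PB)
    show "?B *v v = 0" by (rule P_ext) (auto simp: PB P_fixed[OF v(2)])
    show "P k *v w = 0" if "k \<in> ?D" "w \<in> tangent S v" for k w
      using tan[OF that(2)] that(1) P_P[of k 0 w] by auto
    fix k g y assume *: "k \<in> ?D" "g \<in> vanish_ideal S" "\<And>t y. t \<noteq> 0 \<Longrightarrow> g (act t y) = t powi k * g y"
    show "g (y - ?B *v y) = 0"
    proof (rule weight_vanishing[of g k 0 _ 0])
      show "act t (y - ?B *v y) = 0 + (\<Sum>j\<in>{j\<in>K. int 0 \<le> j}. t powi j *s (P j *v (y - ?B *v y)))" for t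
        by (rule act_eq_sum_ge)
          (use P_zero[of _ y] in \<open>auto simp: matrix_vector_mult_diff_distrib PB act_def\<close>)
    qed (use * in \<open>auto simp: vanish_ideal_def\<close>)
  qed
  then show ?thesis using PB[of k y] P_outside[of k] k by (cases "k \<in> K") auto
qed

text \<open>Here \<open>B\<close> projects along the span of \<open>v\<close> and the weights at
  least \<open>c\<close>. A function of weight below \<open>c\<close> in the ideal vanishes at
  \<open>y - B y\<close>, since this vector differs only in weights at least \<open>c\<close> from a
  multiple of \<open>v\<close>, which lies in \<open>S\<close>.\<close>

lemma chart_weights:
  assumes v: "v \<in> S" "P 0 *v v = v" and l: "pairing l v = 1" and c: "c > 0"
    and tan: "\<And>w. w \<in> tangent S v \<Longrightarrow> \<exists>a. w = a *s v + P (int c) *v w"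
    and y: "y \<in> S"
  shows "k < int c \<Longrightarrow> k \<noteq> 0 \<Longrightarrow> P k *v y = 0"
    and "P 0 *v y = pairing l (P 0 *v y) *s v"
proof -
  \<comment> \<open>\<open>Q\<close> projects onto the line of \<open>v\<close>, reading the
    coefficient from the weight \<open>0\<close> part by means of \<open>l\<close>; then
    \<open>C 0\<close> projects onto a complement of that line in weight \<open>0\<close>.\<close>
  obtain Q where Q: "\<And>w. Q *v w = pairing l (P 0 *v w) *s v"
    using rank_one_matrix by blast
  define D where "D = insert 0 {k\<in>K. k < int c}"
  define C where "C k = (if k = 0 then P 0 - Q else P k)" for k
  define B where "B = (\<Sum>k\<in>D. C k)"
  have fin: "finite D" using finite_K by (simp add: D_def)
  have Cw: "C k *v w = P k *v w - (if k = 0 then Q *v w else 0)" for k w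
    by (simp add: C_def matrix_vector_mult_diff_rdistrib)
  have Bw: "B *v w = (\<Sum>k\<in>D. P k *v w) - Q *v w" for w
    using fin by (simp add: B_def sum_matrix_mult Cw sum_subtractf D_def)
  have PQ: "P j *v (Q *v w) = (if j = 0 then Q *v w else 0)" for j w
    by (simp add: Q vec.scale P_fixed[OF v(2)])
  have QP: "Q *v (P j *v w) = (if j = 0 then Q *v w else 0)" for j w
    by (simp add: Q P_P pairing_zero_right)
  have Qv: "Q *v v = v" by (simp add: Q v l)
  have QQ: "Q *v (Q *v w) = Q *v w" for w
    using Qv by (simp add: Q[of w] vec.scale)
  have PB: "P j *v (B *v w) = (if j \<in> D then P j *v w else 0) - (if j = 0 then Q *v w else 0)" for j w
    unfolding Bw matrix_vector_mult_diff_distrib P_sum_set[OF fin] PQ ..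
  have QB: "Q *v (B *v w) = 0" for w
  proof -
    have "Q *v (B *v w) = Q *v (P 0 *v (B *v w))" by (simp add: QP)
    also have "\<dots> = 0" unfolding PB by (simp add: D_def matrix_vector_mult_diff_distrib QP QQ)
    finally show ?thesis .
  qed
  have "B *v y = 0"
  proof (rule projection_vanishes[OF v _ B_def _ _ _ _ y])
    show "C k *v (P k *v w) = C k *v w" for k w by (simp add: Cw P_P QP)
    show "B *v (B *v y) = B *v y" for y
      by (rule P_ext) (simp add: PB QB, simp add: D_def)
    show "B *v v = 0" by (rule P_ext) (simp add: PB P_fixed[OF v(2)] Qv, simp add: D_def)
    show "C k *v w = 0" if k: "k \<in> D" and w: "w \<in> tangent S v" for k w
    proof -
      obtain a where a: "w = a *s v + P (int c) *v w" using tan[OF w] by blast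
      have "P k *v w = a *s (P k *v v)"
        using k c by (subst a) (auto simp: matrix_vector_right_distrib vec.scale P_P D_def)
      moreover have "Q *v w = a *s v"
        using c by (subst a) (auto simp: matrix_vector_right_distrib vec.scale QP Qv)
      ultimately show ?thesis by (simp add: Cw P_fixed[OF v(2)])
    qed
    fix k g y
    assume *: "k \<in> D" "g \<in> vanish_ideal S" "\<And>t y. t \<noteq> 0 \<Longrightarrow> g (act t y) = t powi k * g y"
    show "g (y - B *v y) = 0"
    proof (rule weight_vanishing[of g k c _ "Q *v y"])
      have "Q *v y \<in> S" unfolding Q by (rule scale[OF v(1)])
      then show "c = 0 \<or> g (Q *v y) = 0" using * by (auto simp: vanish_ideal_def)
      show "act t (y - B *v y) = Q *v y + (\<Sum>j\<in>{j\<in>K. int c \<le> j}. t powi j *s (P j *v (y - B *v y)))" for t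
      proof (rule act_eq_sum_ge)
        show "P j *v (y - B *v y) = P j *v (Q *v y)" if "j < int c" for j
          using that P_zero[of j y] by (auto simp: matrix_vector_mult_diff_distrib PB PQ D_def)
        show "P j *v (Q *v y) = 0" if "int c \<le> j" for j using that c by (simp add: PQ)
        show "act t (Q *v y) = Q *v y" for t by (rule act_fixed) (simp add: PQ)
      qed
    qed (use * c in \<open>auto simp: vanish_ideal_def D_def\<close>)
  qed
  then have Py: "(if j \<in> D then P j *v y else 0) - (if j = 0 then Q *v y else 0) = 0" for j
    using PB[of j y] by simp
  show "P 0 *v y = pairing l (P 0 *v y) *s v"
    using Py[of 0] by (simp add: D_def Q)
  show "P k *v y = 0" if "k < int c" "k \<noteq> 0"
    using Py[of k] that P_outside[of k] by (cases "k \<in> K") (auto simp: D_def)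
qed

end

section \<open>The Lie algebra of linear automorphisms\<close>

definition lie :: "(complex ^ 'n) set \<Rightarrow> (complex ^ 'n ^ 'n) set" where
  "lie S = {X. \<forall>f\<in>vanish_ideal S. \<forall>y\<in>S. pairing (grad f y) (X *v y) = 0}"

text \<open>The infinitesimal orbit of \<open>y\<close>; its dimension is the quantity maximised
  over Euler points.\<close>

definition lie_orbit :: "(complex ^ 'n) set \<Rightarrow> complex ^ 'n \<Rightarrow> (complex ^ 'n) set" where
  "lie_orbit S y = (\<lambda>X. X *v y) ` lie S"

lemma mat_mult_vec: "mat c *v y = c *s (y :: complex ^ 'n)"
  by (simp add: vec_eq_iff matrix_vector_mult_def mat_def if_distrib if_distribR cong: if_cong)

lemma subspace_lie_orbit: "vec.subspace (lie_orbit S y)"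
  unfolding vec.subspace_def
proof (intro conjI ballI allI)
  have "0 \<in> lie S" by (simp add: lie_def pairing_zero_right)
  then show "0 \<in> lie_orbit S y" unfolding lie_orbit_def by force
next
  fix a b assume "a \<in> lie_orbit S y" "b \<in> lie_orbit S y"
  then obtain X Y where XY: "X \<in> lie S" "Y \<in> lie S" "a = X *v y" "b = Y *v y"
    by (auto simp: lie_orbit_def)
  then have "X + Y \<in> lie S" "a + b = (X + Y) *v y"
    by (simp_all add: lie_def matrix_vector_mult_add_rdistrib pairing_add_right)
  then show "a + b \<in> lie_orbit S y" unfolding lie_orbit_def by blast
next
  fix c a assume "a \<in> lie_orbit S y"
  then obtain X where X: "X \<in> lie S" "a = X *v y" by (auto simp: lie_orbit_def)
  have "(mat c ** X) *v z = c *s (X *v z)" for z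
    by (metis mat_mult_vec matrix_vector_mul_assoc)
  with X have "mat c ** X \<in> lie S" "c *s a = (mat c ** X) *v y"
    by (simp_all add: lie_def pairing_scale_right)
  then show "c *s a \<in> lie_orbit S y" unfolding lie_orbit_def by blast
qed

lemma lie_orbit_subset_tangent: "y \<in> S \<Longrightarrow> lie_orbit S y \<subseteq> tangent S y"
  by (auto simp: lie_orbit_def tangent_def lie_def)

text \<open>The identity is the Euler vector field: \<open>f\<close> vanishes at all multiples
  \<open>(1 + s) y\<close>.\<close>

lemma (in irreducible_cone) mat_1_in_lie: "mat 1 \<in> lie S"
proof -
  have "pairing (grad f y) y = 0" if f: "f \<in> vanish_ideal S" and y: "y \<in> S" for f y
  proof -
    have "f (y + s *s y) = 0" for s
      using f scale[OF y, of "1 + s"] by (simp add: vanish_ideal_def vec.scale_left_distrib)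
    moreover have "((\<lambda>s. f (y + s *s y)) has_field_derivative pairing (grad f y) y) (at 0)"
      using f by (intro poly_funs_line_derivative) (simp add: vanish_ideal_def)
    ultimately have "((\<lambda>s. 0) has_field_derivative pairing (grad f y) y) (at 0)" by simp
    then show ?thesis using DERIV_unique[OF DERIV_const] by metis
  qed
  then show ?thesis by (simp add: lie_def)
qed

section \<open>Weights on the Lie algebra\<close>

context graded_cone
begin

text \<open>The infinitesimal generator of \<open>act\<close>, that is, its derivative at
  \<open>t = 1\<close>.\<close>

definition weight_derivation :: "complex ^ 'n ^ 'n" where
  "weight_derivation = (\<Sum>k\<in>K. mat (of_int k) ** P k)"

lemma weight_derivation_mult: "weight_derivation *v y = (\<Sum>k\<in>K. of_int k *s (P k *v y))"
  unfolding weight_derivation_def sum_matrix_mult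
  by (metis mat_mult_vec matrix_vector_mul_assoc)

lemma P_weight_derivation: "P k *v (weight_derivation *v y) = of_int k *s (P k *v y)"
  unfolding weight_derivation_mult P_sum_graded using finite_K P_zero[of k y] by auto

lemma weight_derivation_in_lie: "weight_derivation \<in> lie S"
  unfolding lie_def mem_Collect_eq
proof (intro ballI)
  fix f y assume f: "f \<in> vanish_ideal S" and y: "y \<in> S"
  have "((\<lambda>s. act s y $ j) has_field_derivative (weight_derivation *v y) $ j) (at 1)" for j
    unfolding act_def weight_derivation_mult sum_component vector_smult_component
    by (auto intro!: derivative_eq_intros)
  then have "((\<lambda>s. f (act s y)) has_field_derivative pairing (grad f (act 1 y)) (weight_derivation *v y)) (at 1)"
    using f by (intro poly_funs_chain_rule) (auto simp: vanish_ideal_def)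
  \<comment> \<open>Stability of \<open>S\<close> is known for \<open>s \<noteq> 0\<close> only, so
    \<open>f\<close> along the action is compared with zero on the open set that omits
    \<open>0\<close>.\<close>
  moreover have "((\<lambda>s. f (act s y)) has_field_derivative 0) (at 1)"
    by (rule has_field_derivative_transform_within_open[of "\<lambda>_. 0" _ _ "- {0}"])
      (use f act_S[OF _ y] in \<open>auto simp: vanish_ideal_def\<close>)
  ultimately show "pairing (grad f y) (weight_derivation *v y) = 0"
    using DERIV_unique by (metis act_1)
qed

text \<open>Conjugates of \<open>N\<close> by the action remain tangent to \<open>S\<close>, and the
  coefficient of \<open>t powi c\<close> in this Laurent family is the part of \<open>N\<close> that
  raises weights by \<open>c\<close>. Tangency is a linear condition, so it passes to
  coefficients.\<close>

lemma lie_weight_component: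
  assumes N: "N \<in> lie S"
  obtains M where "M \<in> lie S" "\<And>k y. P k *v (M *v y) = M *v (P (k - c) *v y)"
    "\<And>v. P 0 *v v = v \<Longrightarrow> M *v v = P c *v (N *v v)"
proof -
  define M where "M d = (\<Sum>i\<in>K. P (i + d) ** N ** P i)" for d
  have M: "M d *v y = (\<Sum>i\<in>K. P (i + d) *v (N *v (P i *v y)))" for d y
    by (simp add: M_def sum_matrix_mult matrix_vector_mul_assoc matrix_mul_assoc)
  have PM: "P k *v (M d *v y) = P k *v (N *v (P (k - d) *v y))" for k d y
  proof -
    have "P k *v (\<Sum>i\<in>J. P (i + d) *v (N *v (P i *v y)))
      = (\<Sum>i\<in>J. if i = k - d then P k *v (N *v (P (k - d) *v y)) else 0)" if "finite J" for J
      using that by (induction J) (auto simp: matrix_vector_right_distrib P_P)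
    then show ?thesis using finite_K P_outside[of "k - d"] by (simp add: M)
  qed
  have MP: "M d *v (P j *v y) = P (j + d) *v (N *v (P j *v y))" for j d y
    using finite_K P_outside[of j]
    by (simp add: M P_P if_distrib[of "\<lambda>x. _ *v (_ *v x)"] cong: if_cong)
  \<comment> \<open>The exponents are differences of weights; \<open>c\<close> is inserted so that
    its coefficient can be read off in any case.\<close>
  have "pairing (grad f y) (M c *v y) = 0" if f: "f \<in> vanish_ideal S" and y: "y \<in> S" for f y
  proof (rule laurent_coeffs_zero[of "insert c ((\<lambda>p. fst p - snd p) ` (K \<times> K))" "\<lambda>d. pairing (grad f y) (M d *v y)"])
    let ?D = "insert c ((\<lambda>p. fst p - snd p) ` (K \<times> K))"
    fix t :: complex assume t: "t \<noteq> 0"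
    have "act t (N *v act (1 / t) y) = (\<Sum>d\<in>?D. t powi d *s (M d *v y))"
    proof (rule P_ext)
      fix k
      have "N *v act (1 / t) y = (\<Sum>i\<in>K. (1 / t) powi i *s (N *v (P i *v y)))"
        by (simp add: act_def vec.scale vec.sum)
      then have "P k *v act t (N *v act (1 / t) y)
          = (\<Sum>i\<in>K. t powi (k - i) *s (P k *v (N *v (P i *v y))))"
        using t by (simp add: P_act vec.scale vec.sum vec.scale_sum_right power_int_diff
            power_int_divide_distrib)
      \<comment> \<open>Substitute \<open>d = k - i\<close>; the excluded indices contribute zero
        because a projection vanishes.\<close>
      also have "\<dots> = (\<Sum>d\<in>?D. t powi d *s (P k *v (N *v (P (k - d) *v y))))"
      proof (rule sum.reindex_bij_witness_not_neutral[of "{i \<in> K. k \<notin> K}" "{d \<in> ?D. k \<notin> K \<or> k - d \<notin> K}"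
            _ "\<lambda>d. k - d" "\<lambda>i. k - i"])
        show "finite {i \<in> K. k \<notin> K}" "finite {d \<in> ?D. k \<notin> K \<or> k - d \<notin> K}"
          using finite_K by auto
        show "k - i \<in> ?D - {d \<in> ?D. k \<notin> K \<or> k - d \<notin> K}" if "i \<in> K - {i \<in> K. k \<notin> K}" for i
          using that by (auto intro!: image_eqI[of _ _ "(k, i)"])
      qed (auto simp: P_outside)
      also have "\<dots> = P k *v (\<Sum>d\<in>?D. t powi d *s (M d *v y))"
        by (simp only: vec.sum vec.scale PM)
      finally show "P k *v act t (N *v act (1 / t) y) = P k *v (\<Sum>d\<in>?D. t powi d *s (M d *v y))" .
    qed
    moreover have "pairing (grad f y) (act t (N *v act (1 / t) y)) = 0"
    proof -
      \<comment> \<open>Tangency of \<open>N\<close> is used at \<open>z\<close>, for the composite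
        of \<open>f\<close> with \<open>act t\<close>; this lies in the ideal because
        \<open>act t\<close> preserves \<open>S\<close>.\<close>
      define z where "z = act (1 / t) y"
      have z: "z \<in> S" "act t z = y" using t y act_S[of "1 / t" y] by (auto simp: z_def act_act act_1)
      have "(\<lambda>v. f (act t v)) \<in> vanish_ideal S"
        using f act_S[OF t] poly_funs_subst[of f "\<lambda>v. matrix (act t) *v v"]
        by (auto simp: vanish_ideal_def act_matrix poly_funs_matrix[of "matrix (act t)", unfolded act_matrix])
      then have "pairing (grad (\<lambda>v. f (act t v)) z) (N *v z) = 0" using N z by (simp add: lie_def)
      moreover have "f \<in> poly_funs" using f by (simp add: vanish_ideal_def)
      ultimately show ?thesis
        using grad_matrix_subst[of f "matrix (act t)" z "N *v z"] z(2)
        by (simp add: act_matrix z_def)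
    qed
    ultimately show "(\<Sum>d\<in>?D. t powi d * pairing (grad f y) (M d *v y)) = 0"
      by (simp only: pairing_sum_right pairing_scale_right)
  qed (use finite_K in auto)
  then have "M c \<in> lie S" by (simp add: lie_def)
  moreover have "P k *v (M c *v y) = M c *v (P (k - c) *v y)" for k y
    unfolding PM MP by simp
  moreover have "M c *v v = P c *v (N *v v)" if "P 0 *v v = v" for v
    using MP[of c 0 v] that by simp
  ultimately show ?thesis using that by blast
qed

end

section \<open>Exponentials of nilpotent derivations\<close>

locale nilpotent =
  fixes N :: "complex ^ 'n ^ 'n" and m :: nat
  assumes nilpotent: "\<And>y. ((*v) N ^^ m) y = 0" and pos: "m > 0"
begin

lemma iterate_zero: "((*v) N ^^ j) 0 = 0"
  by (induction j) auto

lemma iterate_add: "((*v) N ^^ j) (y + z) = ((*v) N ^^ j) y + ((*v) N ^^ j) z"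
  by (induction j) (auto simp: matrix_vector_right_distrib)

lemma iterate_scale: "((*v) N ^^ j) (c *s y) = c *s ((*v) N ^^ j) y"
  by (induction j) (auto simp: vec.scale)

lemma iterate_sum: "((*v) N ^^ j) (\<Sum>i\<in>A. y i) = (\<Sum>i\<in>A. ((*v) N ^^ j) (y i))"
  by (induction A rule: infinite_finite_induct) (auto simp: iterate_zero iterate_add)

lemma iterate_ge: "m \<le> j \<Longrightarrow> ((*v) N ^^ j) y = 0"
  using nilpotent[of "((*v) N ^^ (j - m)) y"] funpow_add[of m "j - m" "(*v) N"] by simp

text \<open>The exponential of \<open>t N\<close>, whose series stops because all iterates from
  \<open>m\<close> on vanish.\<close>

definition nexp :: "complex \<Rightarrow> complex ^ 'n \<Rightarrow> complex ^ 'n" where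
  "nexp t y = (\<Sum>j<m. (t ^ j / fact j) *s ((*v) N ^^ j) y)"

lemma nexp_linear: "Vector_Spaces.linear (*s) (*s) (nexp t)"
  by unfold_locales
    (auto simp: nexp_def iterate_add iterate_scale sum.distrib vec.scale_right_distrib
      vec.scale_sum_right mult.commute)

lemma nexp_0: "nexp 0 y = y"
proof -
  have "nexp 0 y = (\<Sum>j<m. if j = 0 then y else 0)"
    unfolding nexp_def by (intro sum.cong) (auto simp: power_0_left)
  then show ?thesis using pos by simp
qed

lemma nexp_add: "nexp s (nexp t y) = nexp (s + t) y"
proof -
  let ?N = "\<lambda>j. ((*v) N ^^ j) y"
  let ?g = "\<lambda>i j. (s ^ i / fact i * (t ^ j / fact j)) *s ?N (i + j)"
  have "nexp s (nexp t y) = (\<Sum>i<m. \<Sum>j<m. ?g i j)"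
    by (simp add: nexp_def iterate_sum iterate_scale funpow_add vec.scale_sum_right)
  also have "\<dots> = (\<Sum>(i, j)\<in>{..<m} \<times> {..<m}. ?g i j)"
    by (simp add: sum.cartesian_product)
  \<comment> \<open>Terms with \<open>i + j \<ge> m\<close> are zero, so the square of indices
    shrinks to a triangle, where the binomial theorem applies.\<close>
  also have "\<dots> = (\<Sum>(i, j)\<in>{(i, j). i + j < m}. ?g i j)"
    by (rule sum.mono_neutral_right) (auto, metis iterate_ge not_le_imp_less)
  also have "\<dots> = (\<Sum>n<m. \<Sum>i\<le>n. ?g i (n - i))"
    by (rule sum.triangle_reindex)
  also have "\<dots> = (\<Sum>n<m. ((s + t) ^ n / fact n) *s ?N n)"
  proof (rule sum.cong[OF refl])
    fix n
    have "(\<Sum>i\<le>n. ?g i (n - i)) = (\<Sum>i\<le>n. s ^ i / fact i * (t ^ (n - i) / fact (n - i))) *s ?N n"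
      by (simp add: vec.scale_sum_left)
    also have "(\<Sum>i\<le>n. s ^ i / fact i * (t ^ (n - i) / fact (n - i))) = (s + t) ^ n / fact n"
      by (simp add: binomial_ring binomial_fact sum_divide_distrib field_simps)
    finally show "(\<Sum>i\<le>n. ?g i (n - i)) = ((s + t) ^ n / fact n) *s ?N n" .
  qed
  finally show ?thesis by (simp add: nexp_def)
qed

lemma nexp_derivative:
  "((\<lambda>t. nexp t y $ i) has_field_derivative (N *v nexp t y) $ i) (at t)"
proof -
  obtain n where Suc: "m = Suc n" using pos gr0_implies_Suc by blast
  let ?N = "\<lambda>j. ((*v) N ^^ j) y"
  have "((\<lambda>t. \<Sum>j<m. t ^ j / fact j * ?N j $ i) has_field_derivative
      (\<Sum>j<m. (of_nat j * t ^ (j - 1)) / fact j * ?N j $ i)) (at t)"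
    by (intro DERIV_sum) (auto intro!: derivative_eq_intros)
  also have "(\<Sum>j<m. (of_nat j * t ^ (j - 1)) / fact j * ?N j $ i)
      = (\<Sum>j<n. t ^ j / fact j * ?N (Suc j) $ i)"
    unfolding Suc sum.lessThan_Suc_shift
    by (simp add: divide_simps del: of_nat_Suc funpow.simps)
  also have "\<dots> = (\<Sum>j<m. t ^ j / fact j * ?N (Suc j) $ i)"
    using iterate_ge[of "Suc n" y] by (simp add: Suc del: funpow.simps)
  also have "\<dots> = (N *v nexp t y) $ i"
    by (simp add: nexp_def vec.sum vec.scale)
  finally show ?thesis by (simp add: nexp_def)
qed

lemma poly_funs_along_nexp:
  assumes "f \<in> poly_funs"
  obtains q where "\<And>t. f (nexp t y) = poly q t"
proof -
  have "\<exists>q. \<forall>t. f (nexp t y) = f 0 + t ^ 0 * poly q t"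
    by (rule poly_funs_along_curve[OF assms, of _ _ _ "\<lambda>i. \<Sum>j<m. monom ((((*v) N ^^ j) y) $ i / fact j) j"])
      (simp add: nexp_def poly_sum poly_monom mult.commute)
  then obtain q where "\<And>t. f (nexp t y) = f 0 + poly q t" by auto
  then show ?thesis using that[of "[:f 0:] + q"] by simp
qed

text \<open>The polynomial \<open>t \<mapsto> f (exp (t N) y)\<close> has derivative \<open>t \<mapsto> (N f) (exp (t N) y)\<close>, and \<open>N f\<close> is
  again in the vanishing ideal: so all its derivatives vanish at \<open>0\<close>.\<close>

lemma nexp_preserves:
  assumes closed: "\<And>y. (\<And>f. f \<in> vanish_ideal S \<Longrightarrow> f y = 0) \<Longrightarrow> y \<in> S"
    and N: "N \<in> lie S" and y: "y \<in> S"
  shows "nexp t y \<in> S"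
proof (rule closed)
  fix f assume f: "f \<in> vanish_ideal S"
  \<comment> \<open>Induction on the degree, for all \<open>f\<close> at once, as the derivative of
    \<open>q\<close> belongs to another element \<open>g\<close> of the ideal. A nonconstant
    \<open>q\<close> would have derivative zero, so \<open>q\<close> is the constant
    \<open>f y = 0\<close>.\<close>
  have zero: "q = 0" if "f \<in> vanish_ideal S" "\<And>t. f (nexp t y) = poly q t" for f q
    using that
  proof (induction "degree q" arbitrary: f q rule: less_induct)
    case less
    have fp: "f \<in> poly_funs" using less.prems(1) by (simp add: vanish_ideal_def)
    define g where "g z = pairing (grad f z) (N *v z)" for z
    have "g \<in> poly_funs"
      unfolding g_def pairing_def
      by (intro poly_funs_sum poly_funs.mult poly_funs_grad[OF fp] poly_funs_matrix)
    then have g: "g \<in> vanish_ideal S"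
      using N less.prems(1) by (simp add: vanish_ideal_def lie_def g_def)
    have "((\<lambda>t. f (nexp t y)) has_field_derivative g (nexp t y)) (at t)" for t
      unfolding g_def by (rule poly_funs_chain_rule[OF fp nexp_derivative])
    then have "(poly q has_field_derivative g (nexp t y)) (at t)" for t
      by (simp add: less.prems(2))
    then have gq: "g (nexp t y) = poly (pderiv q) t" for t
      using DERIV_unique poly_DERIV by blast
    have "degree q = 0"
    proof (rule ccontr)
      assume "degree q \<noteq> 0"
      then have "pderiv q = 0"
        using less.hyps[OF _ g gq] by (simp add: degree_pderiv)
      with \<open>degree q \<noteq> 0\<close> show False by (simp add: pderiv_eq_0_iff)
    qed
    then obtain a where "q = [:a:]" by (metis degree_eq_zeroE)
    moreover have "poly q 0 = 0"
      using less.prems(2)[of 0] less.prems(1) y by (simp add: nexp_0 vanish_ideal_def)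
    ultimately show ?case by simp
  qed
  have "f \<in> poly_funs" using f by (simp add: vanish_ideal_def)
  then obtain q where "\<And>t. f (nexp t y) = poly q t"
    using poly_funs_along_nexp[where y = y] by blast
  with zero[OF f this] show "f (nexp t y) = 0" by simp
qed

end

section \<open>The orbit of an Euler point\<close>

text \<open>The normal form of the action at an Euler point, reached by shifting the weights and
  possibly inverting the torus. The functional \<open>l\<close> serves as coordinate along
  \<open>v\<close>.\<close>

locale euler_chart = graded_cone S K P
  for S :: "(complex ^ 'n) set" and K and P :: "int \<Rightarrow> complex ^ 'n ^ 'n" +
  fixes v l :: "complex ^ 'n" and c :: nat
  assumes v: "v \<in> S" "P 0 *v v = v" and l: "pairing l v = 1" and c: "c > 0"
    and tan: "\<And>w. w \<in> tangent S v \<Longrightarrow> \<exists>a. w = a *s v + P (int c) *v w"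
begin

lemmas weights = chart_weights[OF v l c tan]

text \<open>The vectors \<open>act t y\<close> of \<open>S\<close> expand as
  \<open>v + t ^ k P_k y + ...\<close>, and the leading coefficient is tangent at \<open>v\<close>
  even when \<open>k > 1\<close>: the Hadamard form of \<open>f\<close> can be divided by
  \<open>t ^ k\<close>.\<close>

lemma lowest_term_tangent:
  assumes y: "y \<in> S" "P 0 *v y = v" and k: "k > 0" "\<And>j. j < int k \<Longrightarrow> j \<noteq> 0 \<Longrightarrow> P j *v y = 0"
  shows "P (int k) *v y \<in> tangent S v"
  unfolding tangent_def mem_Collect_eq
proof
  fix f assume f: "f \<in> vanish_ideal S"
  obtain Q where Q: "\<And>w. Q *v w = pairing l (P 0 *v w) *s v"
    using rank_one_matrix by blast
  obtain H where H: "\<And>j. (\<lambda>y. H y $ j) \<in> poly_funs"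
      "\<And>y. f y - f (y - (mat 1 - Q) *v y) = pairing (H y) ((mat 1 - Q) *v y)"
      "\<And>y. (mat 1 - Q) *v y = 0 \<Longrightarrow> H y = grad f y"
    using poly_funs_hadamard[of f "mat 1 - Q"] f unfolding vanish_ideal_def by blast
  have Hv: "H v = grad f v"
    by (rule H(3)) (simp add: matrix_vector_mult_diff_rdistrib Q v l)
  define p where "p i = (\<Sum>j\<in>{j\<in>K. int k \<le> j}. monom ((P j *v y) $ i) (nat (j - int k)))" for i
  define \<gamma> where "\<gamma> t = (\<chi> i. v $ i + t ^ k * poly (p i) t)" for t
  have "\<exists>q. \<forall>t. H (\<gamma> t) $ i = H v $ i + t ^ k * poly q t" for i
    by (rule poly_funs_along_curve[OF H(1), of _ _ _ p]) (simp add: \<gamma>_def)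
  then obtain q where q: "\<And>i t. H (\<gamma> t) $ i = H v $ i + t ^ k * poly (q i) t" by metis
  \<comment> \<open>For \<open>t \<noteq> 0\<close>, \<open>t ^ k * poly \<Phi> t\<close> is
    \<open>f (\<gamma> t) - f v\<close>; the value of \<open>\<Phi>\<close> at \<open>0\<close> is
    the pairing wanted.\<close>
  define \<Phi> where "\<Phi> = (\<Sum>i\<in>UNIV. ([:H v $ i:] + monom 1 k * q i) * p i)"
  have "\<Phi> = 0"
  proof (rule poly_eq_off_zero)
    fix t :: complex assume t: "t \<noteq> 0"
    have "act t y = v + (\<Sum>j\<in>{j\<in>K. int k \<le> j}. t powi j *s (P j *v y))"
      by (rule act_eq_sum_ge) (use k y(2) in \<open>auto simp: P_fixed[OF v(2)] act_fixed[OF v(2)]\<close>)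
    then have \<gamma>: "\<gamma> t = act t y"
      by (auto simp: \<gamma>_def p_def vec_eq_iff poly_sum poly_monom sum_distrib_left
        power_times_shifted_power[OF t] intro!: sum.cong)
    have S: "\<gamma> t \<in> S" using act_S[OF t y(1)] \<gamma> by simp
    have "(mat 1 - Q) *v \<gamma> t = \<gamma> t - v"
      by (simp add: matrix_vector_mult_diff_rdistrib Q \<gamma> P_act y(2) l)
    then have "pairing (H (\<gamma> t)) (\<gamma> t - v) = 0"
      using H(2)[of "\<gamma> t"] f S v(1) by (simp add: vanish_ideal_def)
    moreover have "pairing (H (\<gamma> t)) (\<gamma> t - v) = t ^ k * poly \<Phi> t"
      unfolding pairing_def q by (simp add: \<Phi>_def poly_sum poly_monom \<gamma>_def sum_distrib_left algebra_simps)
    ultimately show "poly \<Phi> t = poly 0 t" using t by simp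
  qed
  then have "poly \<Phi> 0 = 0" by simp
  moreover have "poly (p i) 0 = (P (int k) *v y) $ i" for i
  proof -
    have "poly (p i) 0 = (\<Sum>j\<in>{j\<in>K. int k \<le> j}. if j = int k then (P j *v y) $ i else 0)"
      unfolding p_def poly_sum by (intro sum.cong) (auto simp: poly_monom power_0_left)
    then show ?thesis using finite_K P_outside[of "int k"] by auto
  qed
  ultimately show "pairing (grad f v) (P (int k) *v y) = 0"
    using k(1) by (simp add: \<Phi>_def poly_sum poly_monom pairing_def Hv power_0_left)
qed

text \<open>Otherwise the lowest weight of \<open>y\<close> other than \<open>0\<close> exceeds
  \<open>c\<close>, but its component is tangent at \<open>v\<close>, where only the weights
  \<open>0\<close> and \<open>c\<close> occur.\<close>

lemma slice_trivial:
  assumes y: "y \<in> S" "P 0 *v y = v" and yc: "P (int c) *v y = 0"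
  shows "y = v"
proof (rule ccontr)
  assume "y \<noteq> v"
  define A where "A = {k\<in>K. k \<noteq> 0 \<and> P k *v y \<noteq> 0}"
  have "finite A" using finite_K by (simp add: A_def)
  obtain j where j: "P j *v y \<noteq> P j *v v" using P_ext \<open>y \<noteq> v\<close> by blast
  then have "j \<noteq> 0" using y(2) v(2) by auto
  with j have "j \<in> A" using P_zero[of j y] P_fixed[OF v(2), of j] by (auto simp: A_def)
  define \<mu> where "\<mu> = Min A"
  have "\<mu> \<in> A" unfolding \<mu>_def using Min_in \<open>finite A\<close> \<open>j \<in> A\<close> by blast
  then have Min: "\<mu> \<noteq> 0" "P \<mu> *v y \<noteq> 0" by (auto simp: A_def)
  have low: "P i *v y = 0" if "i < int c" "i \<noteq> 0" for i using weights(1)[OF _ y(1)] that by blast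
  have gt: "\<mu> > int c" using Min low[of \<mu>] yc by (cases "\<mu> = int c"; cases "\<mu> < int c") auto
  then obtain k where k: "\<mu> = int k" using zero_le_imp_eq_int[of \<mu>] by auto
  have below: "P i *v y = 0" if "i < int k" "i \<noteq> 0" for i
    using that Min_le[OF \<open>finite A\<close>, of i] P_zero[of i y] k by (auto simp: A_def \<mu>_def)
  have "P (int k) *v y \<in> tangent S v"
    by (rule lowest_term_tangent[OF y _ below]) (use gt k in auto)
  then obtain a where a: "P (int k) *v y = a *s v + P (int c) *v (P (int k) *v y)" using tan by blast
  have "P (int k) *v y = P (int k) *v (P (int k) *v y)" by (simp add: P_P)
  also have "\<dots> = 0"
    using gt k by (subst a) (simp add: P_P P_fixed[OF v(2)] vec.scale)
  finally show False using Min k by simp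
qed

text \<open>Raising weights by \<open>c\<close>, \<open>N\<close> is nilpotent, and
  \<open>exp(N) y\<close> has weight \<open>0\<close> part \<open>v\<close> and weight
  \<open>c\<close> part \<open>P_c y + N v = 0\<close>. By \<open>slice_trivial\<close> it equals
  \<open>v\<close>, so \<open>exp(-N)\<close> is the required \<open>g\<close>.\<close>

lemma orbit_contains:
  assumes y: "y \<in> S" "P 0 *v y = v"
    and N: "N \<in> lie S" "\<And>k w. P k *v (N *v w) = N *v (P (k - int c) *v w)" "N *v v = - (P (int c) *v y)"
  obtains g where "invertible g" "(*v) g ` S = S" "g *v v = y"
proof -
  have PN: "P k *v ((*v) N ^^ j) w = ((*v) N ^^ j) (P (k - int j * int c) *v w)" for k j w
    by (induction j arbitrary: k) (simp_all add: N(2) algebra_simps)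
  \<comment> \<open>Twice the sum of the absolute weights bounds every difference of weights, so
    \<open>m\<close> steps of length at least \<open>1\<close> lead out of \<open>K\<close>.\<close>
  define m where "m = Suc (nat (2 * (\<Sum>k\<in>K. \<bar>k\<bar>)))"
  interpret nilpotent N m
  proof
    show "m > 0" by (simp add: m_def)
    fix w
    show "((*v) N ^^ m) w = 0"
    proof (rule P_ext)
      fix k
      have "((*v) N ^^ m) (P (k - int m * int c) *v w) = 0" if "k \<in> K"
      proof -
        have M: "\<bar>j\<bar> \<le> (\<Sum>k\<in>K. \<bar>k\<bar>)" if "j \<in> K" for j
          using member_le_sum[of j K abs] that finite_K by auto
        have "int m * 1 \<le> int m * int c" using c by (intro mult_left_mono) auto
        moreover have "int m > 2 * (\<Sum>k\<in>K. \<bar>k\<bar>)" by (simp add: m_def)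
        ultimately have "k - int m * int c \<notin> K"
          using M[OF that] M[of "k - int m * int c"] by auto
        moreover have "((*v) N ^^ i) 0 = 0" for i by (induction i) auto
        ultimately show ?thesis by (simp add: P_outside)
      qed
      then show "P k *v ((*v) N ^^ m) w = P k *v 0"
        by (cases "k \<in> K") (auto simp: PN P_outside)
    qed
  qed
  have low: "P i *v y = 0" if "i < int c" "i \<noteq> 0" for i using weights(1)[OF _ y(1)] that by blast
  have Piter: "P k *v nexp 1 y = (\<Sum>j<m. (1 / fact j) *s ((*v) N ^^ j) (P (k - int j * int c) *v y))" for k
    by (simp add: nexp_def vec.sum vec.scale PN)
  have "P (0 - int j * int c) *v y = 0" if "j \<noteq> 0" for j
  proof (rule low)
    have "int j * int c > 0" using that c by simp
    then show "0 - int j * int c < int c" "0 - int j * int c \<noteq> 0" by linarith+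
  qed
  then have "P 0 *v nexp 1 y = (\<Sum>j<m. if j = 0 then v else 0)"
    unfolding Piter using c by (intro sum.cong) (auto simp: y(2) iterate_zero)
  then have y0: "P 0 *v nexp 1 y = v" using pos by simp
  \<comment> \<open>For \<open>j \<ge> 2\<close> the weight \<open>c - j c\<close> is negative, and
    \<open>y\<close> has no component there.\<close>
  have summand: "(1 / fact j) *s ((*v) N ^^ j) (P (int c - int j * int c) *v y)
      = (if j = 0 then P (int c) *v y else 0) + (if j = 1 then N *v v else 0)" for j
  proof -
    consider "j = 0" | "j = 1" | "j \<ge> 2" by linarith
    then show ?thesis
    proof cases
      case 3
      then have "int 2 * int c \<le> int j * int c" by (intro mult_right_mono) auto
      with 3 c show ?thesis by (simp add: low iterate_zero)
    qed (auto simp: y(2))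
  qed
  \<comment> \<open>If \<open>m = 1\<close>, the sum has no term for \<open>j = 1\<close>, but then
    \<open>N v = 0\<close>.\<close>
  have yc: "P (int c) *v nexp 1 y = 0"
  proof (cases "m = 1")
    case True
    have "N *v v = 0" using nilpotent[of v] True by simp
    then show ?thesis using True N(3) unfolding Piter summand by simp
  next
    case False
    then show ?thesis using pos N(3) unfolding Piter summand sum.distrib by simp
  qed
  have pres: "nexp t w \<in> S" if "w \<in> S" for t w
    using nexp_preserves[OF closed N(1) that] .
  have e: "nexp 1 y = v"
    by (rule slice_trivial[OF pres[OF y(1)] y0 yc])
  define g where "g = matrix (nexp (-1))"
  define h where "h = matrix (nexp 1)"
  have gw: "g *v w = nexp (-1) w" and hw: "h *v w = nexp 1 w" for w
    unfolding g_def h_def by (rule matrix_works[OF nexp_linear])+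
  have gh: "g *v (h *v w) = w" "h *v (g *v w) = w" for w
    by (simp_all add: gw hw nexp_add nexp_0)
  show ?thesis
  proof
    have "g ** h = mat 1" "h ** g = mat 1"
      by (simp_all add: matrix_eq matrix_vector_mul_assoc[symmetric] gh)
    then show "invertible g" unfolding invertible_def by blast
    show "g *v v = y" using gh(1)[of y] by (simp add: hw e)
    show "(*v) g ` S = S"
    proof
      show "(*v) g ` S \<subseteq> S" using pres by (auto simp: gw)
      show "S \<subseteq> (*v) g ` S"
        using gh(1) pres by (metis hw image_eqI subsetI)
    qed
  qed
qed

end

section \<open>Infinitesimal orbits of maximal dimension\<close>

context euler_chart
begin

text \<open>If the orbit directions at \<open>v\<close> missed \<open>P\<^sub>c y\<close> for some \<open>y\<close> of \<open>S\<close>, then at \<open>y\<close> the Lie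
  algebra would have the additional direction of the weight derivation.\<close>

lemma lie_orbit_dim_less:
  assumes y: "y \<in> S" "pairing l (P 0 *v y) \<noteq> 0" and yc: "P (int c) *v y \<notin> lie_orbit S v"
  shows "vec.dim (lie_orbit S v) < vec.dim (lie_orbit S y)"
proof (rule ccontr)
  define \<kappa> where "\<kappa> = pairing l (P 0 *v y)"
  have y0: "P 0 *v y = \<kappa> *s v" unfolding \<kappa>_def by (rule weights(2)[OF _ y(1)])
  have "\<kappa> \<noteq> 0" using y by (simp add: \<kappa>_def)
  \<comment> \<open>Projecting to the weights \<open>0\<close> and \<open>c\<close> makes the
    directions at \<open>y\<close> comparable with those at \<open>v\<close>, which have only these
    weights.\<close>
  define R where "R = P 0 + P (int c)"
  define W where "W = (*v) R ` lie_orbit S y"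
  have R: "R *v w = P 0 *v w + P (int c) *v w" for w
    by (simp add: R_def matrix_vector_mult_add_rdistrib)
  have W: "vec.subspace W"
    unfolding W_def using subspace_lie_orbit matrix_vector_mul_linear_gen
    by (rule vec.linear_subspace_image[rotated])
  have "R *v (weight_derivation *v y) \<in> W"
    using weight_derivation_in_lie by (auto simp: W_def lie_orbit_def)
  then have "of_nat c *s (P (int c) *v y) \<in> W"
    by (simp add: R P_weight_derivation)
  then have "inverse (of_nat c) *s (of_nat c *s (P (int c) *v y)) \<in> W"
    by (rule vec.subspace_scale[OF W])
  then have cW: "P (int c) *v y \<in> W" using c by simp
  \<comment> \<open>The Euler field contributes \<open>\<kappa> v + P_c y\<close>, and
    \<open>P_c y\<close> is already in \<open>W\<close>, so \<open>v\<close> is too.\<close>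
  have "R *v (mat 1 *v y) \<in> W"
    using mat_1_in_lie unfolding W_def lie_orbit_def by blast
  then have "R *v y - P (int c) *v y \<in> W"
    using vec.subspace_diff[OF W _ cW] by simp
  then have "inverse \<kappa> *s (\<kappa> *s v) \<in> W"
    using vec.subspace_scale[OF W, of "R *v y - P (int c) *v y"] by (simp add: R y0)
  then have vW: "v \<in> W" using \<open>\<kappa> \<noteq> 0\<close> by simp
  have sub: "lie_orbit S v \<subseteq> W"
  proof
    fix x assume x: "x \<in> lie_orbit S v"
    then obtain X where X: "X \<in> lie S" "x = X *v v" by (auto simp: lie_orbit_def)
    obtain a where a: "x = a *s v + P (int c) *v x"
      using tan[of x] lie_orbit_subset_tangent[OF v(1)] x by blast
    obtain M where M: "M \<in> lie S" "\<And>k y. P k *v (M *v y) = M *v (P (k - int c) *v y)"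
        "\<And>v. P 0 *v v = v \<Longrightarrow> M *v v = P (int c) *v (X *v v)"
      using lie_weight_component[OF X(1)] by metis
    \<comment> \<open>The weight \<open>c\<close> part \<open>M\<close> of \<open>X\<close> sends
      \<open>P_0 y = \<kappa> v\<close> to \<open>\<kappa> P_c x\<close>; the weight
      \<open>0\<close> part of \<open>M y\<close> would come from weight \<open>- c\<close>, which
      is absent in \<open>y\<close>.\<close>
    have "P (- int c) *v y = 0" using weights(1)[OF _ y(1), of "- int c"] c by simp
    then have "R *v (M *v y) = \<kappa> *s (P (int c) *v x)"
      by (simp add: R M(2) y0 vec.scale M(3)[OF v(2)] X(2))
    moreover have "R *v (M *v y) \<in> W" using M(1) unfolding W_def lie_orbit_def by blast
    ultimately have "inverse \<kappa> *s (\<kappa> *s (P (int c) *v x)) \<in> W"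
      using vec.subspace_scale[OF W] by metis
    then have "P (int c) *v x \<in> W" using \<open>\<kappa> \<noteq> 0\<close> by simp
    then show "x \<in> W"
      by (subst a) (intro vec.subspace_add[OF W] vec.subspace_scale[OF W] vW)
  qed
  assume "\<not> vec.dim (lie_orbit S v) < vec.dim (lie_orbit S y)"
  moreover have "vec.dim W \<le> vec.dim (lie_orbit S y)"
    unfolding W_def by (rule vec.dim_image_le[OF matrix_vector_mul_linear_gen])
  ultimately have "lie_orbit S v = W"
    using vec.subspace_dim_equal[OF subspace_lie_orbit W sub] by simp
  with cW yc show False by simp
qed

text \<open>If \<open>P_c y\<close> were not the weight \<open>c\<close> part of a direction at
  \<open>v\<close>, a linear form would detect this. Irreducibility then yields a \<open>z\<close>
  at which this form, \<open>h\<close> and the weight \<open>0\<close> coordinate are all nonzero,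
  and \<open>lie_orbit_dim_less\<close> contradicts maximality at \<open>z\<close>.\<close>

lemma chart_in_orbit:
  assumes max: "\<And>y. y \<in> S \<Longrightarrow> h y \<noteq> 0 \<Longrightarrow> y \<noteq> 0 \<Longrightarrow> vec.dim (lie_orbit S y) \<le> vec.dim (lie_orbit S v)"
    and h: "h \<in> homogeneous_polys" "h v \<noteq> 0"
    and y: "y \<in> S" "P 0 *v y = v"
  obtains g where "invertible g" "(*v) g ` S = S" "g *v v = y"
proof -
  let ?V = "(*v) (P (int c)) ` lie_orbit S v"
  have V: "vec.subspace ?V"
    using subspace_lie_orbit matrix_vector_mul_linear_gen
    by (rule vec.linear_subspace_image[rotated])
  have "P (int c) *v y \<in> ?V"
  proof (rule ccontr)
    assume "P (int c) *v y \<notin> ?V"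
    then obtain w where w: "\<And>x. x \<in> ?V \<Longrightarrow> pairing x w = 0" "pairing (P (int c) *v y) w \<noteq> 0"
      using pairing_separation[OF V] by blast
    have hom: "(\<lambda>z. \<Sum>i\<in>UNIV. a i * (A *v z) $ i) \<in> homogeneous_polys" for a and A :: "complex ^ 'n ^ 'n"
    proof -
      have "(\<lambda>z. \<Sum>i\<in>UNIV. a i * (A *v z) $ i) \<in> poly_funs"
        by (intro poly_funs_sum poly_funs_cmul poly_funs_matrix)
      moreover have "(\<Sum>i\<in>UNIV. a i * (A *v (t *s z)) $ i) = t ^ 1 * (\<Sum>i\<in>UNIV. a i * (A *v z) $ i)" for t z
        by (simp add: vec.scale sum_distrib_left algebra_simps)
      ultimately show ?thesis unfolding homogeneous_polys_def by blast
    qed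
    have g1: "(\<lambda>z. pairing (P (int c) *v z) w) \<in> homogeneous_polys"
      using hom[of "\<lambda>i. w $ i" "P (int c)"] by (simp add: pairing_def mult.commute)
    have g2: "(\<lambda>z. pairing l (P 0 *v z)) \<in> homogeneous_polys"
      using hom[of "\<lambda>i. l $ i" "P 0"] by (simp add: pairing_def)
    have "\<exists>z\<in>S. pairing (P (int c) *v z) w * pairing l (P 0 *v z) \<noteq> 0"
      using prime[OF g1 g2] w(2) y l v by auto
    then have "\<exists>z\<in>S. (pairing (P (int c) *v z) w * pairing l (P 0 *v z)) * h z \<noteq> 0"
      using prime[OF homogeneous_polys_mult[OF g1 g2] h(1)] h(2) v(1) by auto
    then obtain z where z: "z \<in> S" "pairing (P (int c) *v z) w \<noteq> 0" "pairing l (P 0 *v z) \<noteq> 0" "h z \<noteq> 0"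
      by auto
    have "P (int c) *v z \<notin> lie_orbit S v"
    proof
      assume "P (int c) *v z \<in> lie_orbit S v"
      then have "P (int c) *v (P (int c) *v z) \<in> ?V" by blast
      then have "P (int c) *v z \<in> ?V" by (simp add: P_P)
      with w(1) z(2) show False by blast
    qed
    moreover have "z \<noteq> 0" using z(3) by (auto simp: pairing_zero_right)
    ultimately show False using lie_orbit_dim_less[OF z(1,3)] max[OF z(1,4)] by auto
  qed
  then obtain X where X: "X \<in> lie S" "P (int c) *v y = P (int c) *v (X *v v)"
    by (auto simp: lie_orbit_def)
  \<comment> \<open>The sign is the one for which \<open>exp(N)\<close> cancels the weight
    \<open>c\<close> part of \<open>y\<close>.\<close>
  have "(- 1) *s (X *v v) \<in> lie_orbit S v"
    using X(1) by (intro vec.subspace_scale[OF subspace_lie_orbit]) (auto simp: lie_orbit_def)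
  then obtain Y where Y: "Y \<in> lie S" "Y *v v = - (X *v v)" by (auto simp: lie_orbit_def)
  obtain M where M: "M \<in> lie S" "\<And>k y. P k *v (M *v y) = M *v (P (k - int c) *v y)"
      "\<And>v. P 0 *v v = v \<Longrightarrow> M *v v = P (int c) *v (Y *v v)"
    using lie_weight_component[OF Y(1)] by metis
  have "M *v v = - (P (int c) *v y)"
    by (simp add: M(3)[OF v(2)] Y(2) X(2) vec.neg)
  then show ?thesis using orbit_contains[OF y M(1,2)] that by blast
qed

end

text \<open>The dimensions of infinitesimal orbits are bounded by that of \<open>V\<close>, so
  \<open>v\<close> can be chosen with the largest one among vectors where \<open>h\<close> is
  nonzero. The locus \<open>b \<noteq> 0\<close> is its chart.\<close>

lemma (in irreducible_cone) cone_has_large_orbit: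
  assumes h: "h \<in> homogeneous_polys" and ex: "\<exists>v\<in>S. v \<noteq> 0 \<and> h v \<noteq> 0"
    and charts: "\<And>v l. v \<in> S \<Longrightarrow> v \<noteq> 0 \<Longrightarrow> h v \<noteq> 0 \<Longrightarrow> pairing l v = 1 \<Longrightarrow> \<exists>K P c. euler_chart S K P v l c"
  obtains v b where "v \<in> S" "pairing b v = 1"
    "\<And>y. y \<in> S \<Longrightarrow> pairing b y \<noteq> 0 \<Longrightarrow> \<exists>g a. invertible g \<and> (*v) g ` S = S \<and> a \<noteq> 0 \<and> g *v v = a *s y"
proof -
  let ?Q = "\<lambda>v. v \<in> S \<and> v \<noteq> 0 \<and> h v \<noteq> 0" and ?d = "\<lambda>v. vec.dim (lie_orbit S v)"
  have "\<exists>v. ?Q v \<and> (\<forall>y. ?Q y \<longrightarrow> ?d y \<le> ?d v)"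
  proof -
    obtain v0 where "?Q v0" using ex by blast
    moreover have "\<forall>y. ?Q y \<longrightarrow> ?d y < Suc CARD('n)"
      using vec.dim_subset[OF subset_UNIV] unfolding vec_dim_card less_Suc_eq_le by blast
    ultimately show ?thesis by (rule Lattices_Big.ex_has_greatest_nat)
  qed
  then obtain v where vS: "v \<in> S" "v \<noteq> 0" "h v \<noteq> 0" and max: "\<And>y. ?Q y \<Longrightarrow> ?d y \<le> ?d v"
    by blast
  obtain i where i: "v $ i \<noteq> 0" using vS(2) by (auto simp: vec_eq_iff)
  \<comment> \<open>A coordinate that is nonzero at \<open>v\<close>, rescaled to the value
    \<open>1\<close> there.\<close>
  define l where "l = (1 / v $ i) *s axis i 1"
  have l: "pairing l v = 1" using i by (simp add: l_def pairing_scale_left pairing_axis_left)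
  obtain K P c where chart: "euler_chart S K P v l c" using charts[OF vS l] by blast
  interpret euler_chart S K P v l c by (rule chart)
  \<comment> \<open>\<open>b\<close> represents the linear form that reads the coefficient of
    \<open>v\<close> in the weight \<open>0\<close> part.\<close>
  define b where "b = (\<chi> j. pairing l (P 0 *v axis j 1))"
  have b: "pairing b w = pairing l (P 0 *v w)" for w
  proof -
    have "pairing l (P 0 *v w) = pairing l (P 0 *v (\<Sum>j\<in>UNIV. w $ j *s axis j 1))"
      by (simp add: basis_expansion)
    also have "\<dots> = pairing b w"
      unfolding vec.sum vec.scale pairing_sum_right pairing_scale_right
      unfolding pairing_def[of b] by (simp add: b_def mult.commute)
    finally show ?thesis ..
  qed
  show ?thesis
  proof
    show "v \<in> S" by (rule vS)
    show "pairing b v = 1" by (simp add: b v(2) l)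
    fix y assume y: "y \<in> S" "pairing b y \<noteq> 0"
    define a where "a = inverse (pairing b y)"
    have "P 0 *v y = pairing b y *s v" using weights(2)[OF _ y(1)] by (simp add: b)
    then have "P 0 *v (a *s y) = v" using y(2) by (simp add: vec.scale a_def)
    then obtain g where "invertible g" "(*v) g ` S = S" "g *v v = a *s y"
      using chart_in_orbit[of h "a *s y"] max h vS(3) scale[OF y(1)] by blast
    moreover have "a \<noteq> 0" using y(2) by (simp add: a_def)
    ultimately show "\<exists>g a. invertible g \<and> (*v) g ` S = S \<and> a \<noteq> 0 \<and> g *v v = a *s y" by blast
  qed
qed

section \<open>The affine cone over a projective variety\<close>

lemma span_in_proj_space: "y \<noteq> 0 \<Longrightarrow> vec.span {y} \<in> proj_space"
  by (simp add: proj_space_def vec.dim_eq_card_independent[of "{y}", unfolded vec.dim_span])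

lemma proj_space_line:
  assumes "L \<in> proj_space" "y \<in> L" "y \<noteq> 0"
  shows "L = vec.span {y}"
proof -
  obtain v where v: "v \<noteq> 0" "L = vec.span {v}" using assms(1) by (rule proj_space_eq_span)
  then obtain a where a: "y = a *s v" using assms(2) by (auto simp: vec.span_singleton)
  then have "a \<noteq> 0" using assms(3) by auto
  then have "v = inverse a *s y" by (simp add: a)
  then have "v \<in> vec.span {y}" by (auto simp: vec.span_singleton)
  then have "vec.span {v} \<subseteq> vec.span {y}" by (intro vec.span_minimal) auto
  moreover have "vec.span {y} \<subseteq> vec.span {v}"
    using assms(2) v(2) by (intro vec.span_minimal) auto
  ultimately show ?thesis using v(2) by blast
qed

lemma vanishes_at_span:
  assumes "f \<in> homogeneous_polys" "y \<noteq> 0"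
  shows "vanishes_at f (vec.span {y}) \<longleftrightarrow> f y = 0"
proof -
  obtain d where "\<And>c v. f (c *s v) = c ^ d * f v" using assms(1) by (auto simp: homogeneous_polys_def)
  then show ?thesis by (auto simp: vanishes_at_def vec.span_singleton intro: exI[of _ 1] dest: bspec[of _ _ y])
qed

lemma pairing_homogeneous: "(\<lambda>z. pairing a z) \<in> homogeneous_polys"
  by (auto simp: homogeneous_polys_def pairing_scale_right pairing_def[of a] sum_distrib_left algebra_simps
    intro!: poly_funs_sum poly_funs.intros exI[of _ 1])

locale variety =
  fixes Z :: "(complex ^ 'n) set set"
  assumes var: "projective_variety Z"
begin

lemma Z_proj: "L \<in> Z \<Longrightarrow> L \<in> proj_space"
  using var by (auto simp: irreducible_closed_def closedin_zariski zero_locus_def)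

lemma span_in_Z: "y \<noteq> 0 \<Longrightarrow> vec.span {y} \<in> Z \<longleftrightarrow> y \<in> \<Union> Z"
  using proj_space_line[OF Z_proj] vec.span_base[of y "{y}"] by auto

lemma Z_span:
  assumes "L \<in> Z"
  obtains y where "y \<noteq> 0" "L = vec.span {y}" "y \<in> \<Union> Z"
  using proj_space_eq_span[OF Z_proj[OF assms]] assms span_in_Z by metis

lemma zero_in_cone: "0 \<in> \<Union> Z"
proof -
  obtain L where "L \<in> Z" using var by (auto simp: irreducible_closed_def)
  then show ?thesis using Z_proj vec.subspace_0 by (auto simp: proj_space_def)
qed

lemma cone: "irreducible_cone (\<Union> Z)"
proof
  show "c *s y \<in> \<Union> Z" if y: "y \<in> \<Union> Z" for c y
  proof -
    obtain L where L: "L \<in> Z" "y \<in> L" using y by blast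
    then have "vec.subspace L" using Z_proj by (simp add: proj_space_def)
    with L show ?thesis using vec.subspace_scale by blast
  qed
next
  obtain R where R: "R \<subseteq> homogeneous_polys" "Z = zero_locus R"
    using var by (auto simp: irreducible_closed_def closedin_zariski)
  {
    fix y assume y: "\<And>f. f \<in> vanish_ideal (\<Union> Z) \<Longrightarrow> f y = 0"
    show "y \<in> \<Union> Z"
    proof (cases "y = 0")
      case False
      have "f y = 0" if "f \<in> R" for f
      proof (rule y)
        show "f \<in> vanish_ideal (\<Union> Z)"
          using that R by (auto simp: vanish_ideal_def homogeneous_polys_def zero_locus_def vanishes_at_def)
      qed
      then have "vec.span {y} \<in> Z"
        using R False by (auto simp: zero_locus_def span_in_proj_space vanishes_at_span)
      then show ?thesis by (simp add: span_in_Z False)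
    qed (use zero_in_cone in simp)
  }
  fix f g :: "complex ^ 'n \<Rightarrow> complex"
  assume f: "f \<in> homogeneous_polys" and g: "g \<in> homogeneous_polys" and fg: "\<forall>y\<in>\<Union> Z. f y * g y = 0"
  \<comment> \<open>Adding \<open>f\<close> or \<open>g\<close> to the equations covers
    \<open>Z\<close> by two closed subsets, one of which must be all of \<open>Z\<close>.\<close>
  let ?A = "zero_locus (insert f R)" and ?B = "zero_locus (insert g R)"
  have vz: "vanishes_at f L \<or> vanishes_at g L" if "L \<in> Z" for L
  proof -
    obtain y where y: "y \<noteq> 0" "L = vec.span {y}" "y \<in> \<Union> Z" using Z_span[OF \<open>L \<in> Z\<close>] .
    then have "f y * g y = 0" using fg by blast
    then show ?thesis using f g y(1) by (simp add: y(2) vanishes_at_span)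
  qed
  have "closedin zariski ?A" "closedin zariski ?B"
    using R f g by (auto simp: closedin_zariski intro: exI[of _ "insert f R"] exI[of _ "insert g R"])
  moreover have "Z = ?A \<union> ?B"
    using vz R(2) by (auto simp: zero_locus_def)
  ultimately have "Z = ?A \<or> Z = ?B" using var unfolding irreducible_closed_def by blast
  then show "(\<forall>y\<in>\<Union> Z. f y = 0) \<or> (\<forall>y\<in>\<Union> Z. g y = 0)"
    by (auto simp: zero_locus_def vanishes_at_def)
qed

sublocale irreducible_cone "\<Union> Z" by (rule cone)

text \<open>Composing with the scaling by \<open>a\<close> keeps a polynomial in the ideal and moves
  the tangency condition from \<open>v\<close> to \<open>a v\<close>. Thus the isotropy condition on
  \<open>cone_tangent_space\<close> becomes available on \<open>tangent\<close>.\<close>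

lemma tangent_subset_cone_tangent_space:
  "tangent (\<Union> Z) v \<subseteq> cone_tangent_space Z (vec.span {v})"
  unfolding cone_tangent_space_def
proof (intro subsetI CollectI ballI)
  fix w f u assume w: "w \<in> tangent (\<Union> Z) v" and f: "f \<in> homogeneous_ideal Z"
    and u': "u \<in> vec.span {v} - {0}"
  then have u: "u \<in> vec.span {v}" "u \<noteq> 0" by auto
  obtain a where a: "u = a *s v" using u(1) by (auto simp: vec.span_singleton)
  have fp: "f \<in> poly_funs" using f by (simp add: homogeneous_ideal_def homogeneous_polys_def)
  have "f (mat a *v z) = 0" if "z \<in> \<Union> Z" for z
    using f scale[OF that, of a] by (auto simp: homogeneous_ideal_def vanishes_at_def mat_mult_vec)
  then have "(\<lambda>z. f (mat a *v z)) \<in> vanish_ideal (\<Union> Z)"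
    unfolding vanish_ideal_def mem_Collect_eq
    using poly_funs_subst[OF fp poly_funs_matrix[of "mat a"]] by blast
  then have "pairing (grad (\<lambda>z. f (mat a *v z)) v) w = 0" using w unfolding tangent_def by blast
  then have "a * pairing (grad f u) w = 0"
    unfolding grad_matrix_subst[OF fp] by (simp add: mat_mult_vec a pairing_scale_right)
  then have "pairing (grad f u) w = 0" using a u(2) by auto
  then show "deriv (\<lambda>s. f (u + s *s w)) 0 = 0"
    using DERIV_imp_deriv[OF poly_funs_line_derivative[OF fp, of u w]] by simp
qed

end

section \<open>The grading of a multiplicative subgroup\<close>

text \<open>Complete reducibility for a one-dimensional torus: the matrix coefficients of the
  Laurent polynomial \<open>\<rho>\<close> are the projections. Multiplicativity of
  \<open>\<rho>\<close> makes them orthogonal idempotents, and \<open>\<rho> 1 = mat 1\<close> makes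
  them sum to the identity.\<close>

lemma multiplicative_subgroup_grading:
  fixes \<rho> :: "complex \<Rightarrow> complex ^ 'n ^ 'n"
  assumes \<rho>: "multiplicative_subgroup \<rho>"
  obtains K P where "grading K P" "\<And>t y. t \<noteq> 0 \<Longrightarrow> \<rho> t *v y = grading.act K P t y"
proof -
  have "\<forall>i j. \<exists>p m. \<forall>t. t \<noteq> 0 \<longrightarrow> \<rho> t $ i $ j = poly p t / t ^ m"
    using \<rho> by (simp add: multiplicative_subgroup_def)
  then obtain p m where pm: "\<And>i j t. t \<noteq> 0 \<Longrightarrow> \<rho> t $ i $ j = poly (p i j) t / t ^ m i j" by metis
  \<comment> \<open>\<open>t ^ M\<close> is a common denominator of all entries; below,
    \<open>N\<close> bounds the degrees of the numerators.\<close>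
  define M where "M = (\<Sum>i\<in>UNIV. \<Sum>j\<in>UNIV. m i j)"
  have M: "m i j \<le> M" for i j
  proof -
    have "m i j \<le> (\<Sum>j\<in>UNIV. m i j)" by (rule member_le_sum) auto
    also have "\<dots> \<le> M" unfolding M_def by (rule member_le_sum[of i UNIV "\<lambda>i. \<Sum>j\<in>UNIV. m i j"]) auto
    finally show ?thesis .
  qed
  define q where "q i j = p i j * monom 1 (M - m i j)" for i j
  have q: "t ^ M * \<rho> t $ i $ j = poly (q i j) t" if "t \<noteq> 0" for i j t
    using M[of i j] that by (simp add: pm q_def poly_monom power_diff)
  define N where "N = (\<Sum>i\<in>UNIV. \<Sum>j\<in>UNIV. degree (q i j))"
  have N: "degree (q i j) \<le> N" for i j
  proof -
    have "degree (q i j) \<le> (\<Sum>j\<in>UNIV. degree (q i j))" by (rule member_le_sum) auto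
    also have "\<dots> \<le> N" unfolding N_def by (rule member_le_sum[of i UNIV "\<lambda>i. \<Sum>j\<in>UNIV. degree (q i j)"]) auto
    finally show ?thesis .
  qed
  \<comment> \<open>The power \<open>t powi k\<close> in an entry has index \<open>k + M\<close> in
    its numerator.\<close>
  define P where "P k = (\<chi> i j. if k + int M \<ge> 0 then coeff (q i j) (nat (k + int M)) else 0)" for k
  define K where "K = (\<lambda>n. int n - int M) ` {..N}"
  have finK: "finite K" by (simp add: K_def)
  have out: "P k = 0" if "k \<notin> K" for k
  proof -
    have "coeff (q i j) (nat (k + int M)) = 0" if "k + int M \<ge> 0" for i j
    proof (rule coeff_eq_0)
      have "nat (k + int M) \<notin> {..N}" using \<open>k \<notin> K\<close> that unfolding K_def by force
      then show "degree (q i j) < nat (k + int M)" using N[of i j] by simp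
    qed
    then show ?thesis by (simp add: P_def vec_eq_iff)
  qed
  have entry: "\<rho> t $ i $ j = (\<Sum>k\<in>K. t powi k * P k $ i $ j)" if t: "t \<noteq> 0" for t i j
  proof -
    have "(\<Sum>k\<in>K. t powi k * P k $ i $ j) = (\<Sum>n\<le>N. t powi (int n - int M) * coeff (q i j) n)"
      unfolding K_def by (subst sum.reindex) (auto simp: inj_on_def P_def)
    also have "\<dots> = (\<Sum>n\<le>N. coeff (q i j) n * t ^ n) / t ^ M"
      using t by (simp add: power_int_diff sum_divide_distrib mult.commute)
    also have "(\<Sum>n\<le>N. coeff (q i j) n * t ^ n) = poly (q i j) t"
      unfolding poly_altdef using N[of i j] by (intro sum.mono_neutral_right) (auto simp: coeff_eq_0)
    finally have "t ^ M * (\<Sum>k\<in>K. t powi k * P k $ i $ j) = t ^ M * \<rho> t $ i $ j"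
      using q[OF t, of i j] t by (simp add: field_simps)
    then show ?thesis using t by simp
  qed
  have act: "\<rho> t *v y = (\<Sum>k\<in>K. t powi k *s (P k *v y))" if "t \<noteq> 0" for t y
    by (simp add: vec_eq_iff matrix_vector_mult_def entry[OF that] sum_distrib_right sum_distrib_left
        sum.swap[of _ UNIV] mult.assoc)
  have coeff_unique: "a k = b k"
    if "\<And>t. t \<noteq> 0 \<Longrightarrow> (\<Sum>k\<in>K. t powi k *s a k) = (\<Sum>k\<in>K. t powi k *s b k)" "k \<in> K"
    for a b :: "int \<Rightarrow> complex ^ 'n" and k
    using laurent_coeffs_zero_vec[OF finK _ that(2), of "\<lambda>k. a k - b k"] that(1)
    by (simp add: vec.scale_right_diff_distrib sum_subtractf)
  \<comment> \<open>Coefficients of powers of \<open>s\<close> are compared first, with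
    \<open>t\<close> fixed; for \<open>PP\<close> those of powers of \<open>t\<close>
    follow.\<close>
  have mult: "P k *v (\<rho> t *v y) = t powi k *s (P k *v y)" if "t \<noteq> 0" "k \<in> K" for t k y
  proof (rule coeff_unique[OF _ \<open>k \<in> K\<close>])
    fix s :: complex assume "s \<noteq> 0"
    with that \<rho> have "\<rho> s *v (\<rho> t *v y) = \<rho> (s * t) *v y"
      by (simp add: multiplicative_subgroup_def matrix_vector_mul_assoc)
    then show "(\<Sum>k\<in>K. s powi k *s (P k *v (\<rho> t *v y))) = (\<Sum>k\<in>K. s powi k *s (t powi k *s (P k *v y)))"
      using that \<open>s \<noteq> 0\<close> by (simp add: act power_int_mult_distrib)
  qed
  have PP: "P k *v (P j *v y) = (if j = k then P k *v y else 0)" if "k \<in> K" "j \<in> K" for j k y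
  proof (rule coeff_unique[OF _ \<open>j \<in> K\<close>, of "\<lambda>j. P k *v (P j *v y)" "\<lambda>j. if j = k then P k *v y else 0"])
    fix t :: complex assume "t \<noteq> 0"
    have "(\<Sum>j\<in>K. t powi j *s (P k *v (P j *v y))) = P k *v (\<rho> t *v y)"
      using \<open>t \<noteq> 0\<close> by (simp add: act vec.sum vec.scale)
    also have "\<dots> = (\<Sum>j\<in>K. if j = k then t powi k *s (P k *v y) else 0)"
      using mult \<open>t \<noteq> 0\<close> that finK by simp
    also have "\<dots> = (\<Sum>j\<in>K. t powi j *s (if j = k then P k *v y else 0))"
      by (intro sum.cong) auto
    finally show "(\<Sum>j\<in>K. t powi j *s (P k *v (P j *v y))) = (\<Sum>j\<in>K. t powi j *s (if j = k then P k *v y else 0))" .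
  qed
  have "\<rho> 1 = mat 1"
  proof -
    \<comment> \<open>An invertible idempotent is the identity.\<close>
    have "\<rho> 1 ** \<rho> 1 = \<rho> 1" and "invertible (\<rho> 1)"
      using \<rho> unfolding multiplicative_subgroup_def by (metis mult_1 zero_neq_one)+
    then obtain A where "A ** \<rho> 1 = mat 1" by (auto simp: invertible_def)
    then show ?thesis by (metis \<open>\<rho> 1 ** \<rho> 1 = \<rho> 1\<close> matrix_mul_assoc matrix_mul_lid)
  qed
  have g: "grading K P"
  proof
    show "P j ** P k = (if j = k then P k else 0)" for j k
    proof (cases "j \<in> K \<and> k \<in> K")
      case True
      then show ?thesis using PP[of j k] by (auto simp: matrix_eq matrix_vector_mul_assoc[symmetric])
    next
      case False
      then show ?thesis using out[of j] out[of k] by (auto simp: matrix_eq matrix_vector_mul_assoc[symmetric])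
    qed
    have "(\<Sum>k\<in>K. P k) *v y = \<rho> 1 *v y" for y
      by (simp add: act sum_matrix_mult)
    then show "(\<Sum>k\<in>K. P k) = mat 1" by (simp add: matrix_eq \<open>\<rho> 1 = mat 1\<close>)
  qed (use finK out in auto)
  then show ?thesis using that act by (simp add: grading.act_def)
qed

text \<open>Because of this, a weight can be read off from the eigenvalue at the single element
  \<open>t = 2\<close>.\<close>

lemma powi_2_inject: "(2 :: complex) powi j = 2 powi k \<longleftrightarrow> j = k"
proof
  assume "(2 :: complex) powi j = 2 powi k"
  then have "norm ((2 :: complex) powi j) = norm ((2 :: complex) powi k)" by simp
  then have "(2 :: real) powi j = 2 powi k" by (simp add: norm_power_int)
  then show "j = k" using power_int_strict_increasing[of j k "2::real"] power_int_strict_increasing[of k j "2::real"]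
    by (cases j k rule: linorder_cases) auto
qed simp

section \<open>Normalising the weights at an Euler point\<close>

context grading
begin

text \<open>The shift moves weight \<open>m\<close> to weight \<open>0\<close>, and
  \<open>e = - 1\<close> reverses the weights by inverting the torus. The shift only multiplies the
  action by a scalar, which a cone does not see.\<close>

lemma twisted_grading:
  assumes e: "e = 1 \<or> e = (- 1 :: int)"
  shows "grading ((\<lambda>k. e * (k - m)) ` K) (\<lambda>k. P (m + e * k))"
    and "t \<noteq> 0 \<Longrightarrow> grading.act ((\<lambda>k. e * (k - m)) ` K) (\<lambda>k. P (m + e * k)) t y
      = (t powi (- (e * m))) *s act (t powi e) y"
proof -
  let ?K = "(\<lambda>k. e * (k - m)) ` K" and ?P = "\<lambda>k. P (m + e * k)"
  have inj: "inj_on (\<lambda>k. e * (k - m)) K" using e by (auto simp: inj_on_def)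
  have unshift: "m + e * (e * (k - m)) = k" for k using e by auto
  show g: "grading ?K ?P"
  proof
    show "?P k = 0" if "k \<notin> ?K" for k
    proof (rule P_outside)
      have "e * ((m + e * k) - m) = k" using e by auto
      then show "m + e * k \<notin> K" using that by (metis image_eqI)
    qed
    show "?P j ** ?P k = (if j = k then ?P k else 0)" for j k
      using e by (auto simp: P_mult)
    show "(\<Sum>k\<in>?K. ?P k) = mat 1"
      unfolding sum.reindex[OF inj] o_def unshift by (rule P_sum)
  qed (simp add: finite_K)
  assume t: "t \<noteq> 0"
  have "grading.act ?K ?P t y = (\<Sum>k\<in>K. t powi (e * (k - m)) *s (P k *v y))"
    unfolding grading.act_def[OF g] sum.reindex[OF inj] o_def unshift ..
  also have "\<dots> = (t powi (- (e * m))) *s act (t powi e) y"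
  proof -
    have "t powi (e * (k - m)) = t powi (- (e * m)) * (t powi e) powi k" for k
      using t by (simp add: right_diff_distrib power_int_mult power_int_diff power_int_minus field_simps)
    then show ?thesis by (simp add: act_def vec.scale_sum_right)
  qed
  finally show "grading.act ?K ?P t y = (t powi (- (e * m))) *s act (t powi e) y" .
qed

lemma eigenvector_weight:
  assumes "act 2 v = \<alpha> *s v" "v \<noteq> 0"
  obtains m where "P m *v v = v" "\<alpha> = 2 powi m"
proof -
  have e: "(2 powi k - \<alpha>) *s (P k *v v) = 0" for k
  proof -
    have "2 powi k *s (P k *v v) = \<alpha> *s (P k *v v)"
      using P_act[of k 2 v] unfolding assms(1) vec.scale by (rule sym)
    then show ?thesis by (simp only: vec.scale_left_diff_distrib diff_self)
  qed
  obtain m where m: "P m *v v \<noteq> 0" using P_ext[of v 0] assms(2) by auto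
  with e[of m] have \<alpha>: "\<alpha> = 2 powi m" by auto
  have "P k *v v = 0" if "k \<noteq> m" for k
    using e[of k] that powi_2_inject[of k m] by (auto simp: \<alpha>)
  then have "P m *v v = v" by - (rule P_ext, simp add: P_P)
  with \<alpha> show ?thesis using that by blast
qed

text \<open>It suffices to look at \<open>t = 2\<close>, because the integral powers of \<open>2\<close> are distinct.\<close>

lemma isotropy_weight:
  assumes v: "P m *v v = v"
    and T: "\<And>w. w \<in> T \<Longrightarrow> inverse (2 powi m) *s act 2 w - \<gamma> *s w \<in> vec.span {v}"
  shows "(\<forall>w\<in>T. P m *v w = w) \<or> (\<exists>d. d \<noteq> 0 \<and> (\<forall>w\<in>T. \<exists>a. w = a *s v + P (m + d) *v w))"
proof -
  have Pv: "P k *v v = (if k = m then v else 0)" for k using P_P[of k m v] v by simp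
  have w: "\<exists>b. \<forall>k. (2 powi (k - m) - \<gamma>) *s (P k *v w) = (if k = m then b *s v else 0)" if wT: "w \<in> T" for w
  proof -
    obtain b where b: "inverse (2 powi m) *s act 2 w - \<gamma> *s w = b *s v"
      using T[OF wT] by (auto simp: vec.span_singleton)
    have "(2 powi (k - m) - \<gamma>) *s (P k *v w) = (if k = m then b *s v else 0)" for k
    proof -
      have "P k *v (inverse (2 powi m) *s act 2 w - \<gamma> *s w) = (2 powi (k - m) - \<gamma>) *s (P k *v w)"
        by (simp add: matrix_vector_mult_diff_distrib vec.scale P_act power_int_diff divide_inverse
            vec.scale_left_diff_distrib mult.commute)
      then have "(2 powi (k - m) - \<gamma>) *s (P k *v w) = b *s (P k *v v)" unfolding b vec.scale by (rule sym)
      then show ?thesis by (cases "k = m") (simp_all only: Pv vec.scale_zero_right if_True if_False simp_thms)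
    qed
    then show ?thesis by blast
  qed
  \<comment> \<open>If \<open>\<gamma>\<close> is a power of \<open>2\<close> with exponent
    \<open>d \<noteq> 0\<close>, then \<open>d\<close> is the common weight shift of
    \<open>T\<close> modulo \<open>v\<close>; otherwise all weights other than \<open>m\<close> are
    excluded.\<close>
  show ?thesis
  proof (cases "\<exists>d. d \<noteq> 0 \<and> 2 powi d = \<gamma>")
    case False
    have "P m *v w = w" if wT: "w \<in> T" for w
    proof (rule P_ext)
      fix k
      have "2 powi (k - m) \<noteq> \<gamma>" if "k \<noteq> m" using False that by (metis right_minus_eq)
      with w[OF wT] have "P k *v w = 0" if "k \<noteq> m" using that by (metis right_minus_eq vec.scale_eq_0_iff)
      then show "P k *v (P m *v w) = P k *v w" by (auto simp: P_P)
    qed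
    then show ?thesis by blast
  next
    case True
    then obtain d where d: "d \<noteq> 0" "2 powi d = \<gamma>" by blast
    have "\<exists>a. w = a *s v + P (m + d) *v w" if wT: "w \<in> T" for w
    proof -
      obtain b where b: "\<And>k. (2 powi (k - m) - \<gamma>) *s (P k *v w) = (if k = m then b *s v else 0)"
        using w[OF wT] by blast
      \<comment> \<open>This allows solving the equation in weight \<open>m\<close>, where
        \<open>w\<close> therefore has a multiple of \<open>v\<close>.\<close>
      have "\<gamma> \<noteq> 1" using d powi_2_inject[of d 0] by auto
      have m: "P m *v w = (b / (1 - \<gamma>)) *s v"
      proof -
        have "P m *v w = inverse (1 - \<gamma>) *s ((1 - \<gamma>) *s (P m *v w))"
          using \<open>\<gamma> \<noteq> 1\<close> left_inverse[of "1 - \<gamma>"] unfolding vec.scale_scale by simp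
        also have "(1 - \<gamma>) *s (P m *v w) = b *s v" using b[of m] by simp
        finally show ?thesis by (simp add: divide_inverse mult.commute)
      qed
      have "P k *v w = 0" if "k \<noteq> m" "k \<noteq> m + d" for k
      proof -
        have "2 powi (k - m) \<noteq> \<gamma>" using that d(2) powi_2_inject[of "k - m" d] by auto
        then show ?thesis using b[of k] that by simp
      qed
      then have "w = (b / (1 - \<gamma>)) *s v + P (m + d) *v w"
        by - (rule P_ext, use d(1) in \<open>auto simp: matrix_vector_right_distrib vec.scale Pv P_P m\<close>)
      then show ?thesis by blast
    qed
    then show ?thesis using d(1) by blast
  qed
qed

end

section \<open>Euler points of a projective variety\<close>

context variety
begin

text \<open>If the tangent weight differs from that of \<open>v\<close>, a twist of the grading
  gives the chart. If not, the torus acts trivially on \<open>Z\<close>, and the isolated fixed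
  point is all of \<open>Z\<close>.\<close>

lemma euler_point_chart:
  assumes \<rho>: "euler_type \<rho> Z (vec.span {v})" and v: "v \<noteq> 0" and l: "pairing l v = 1"
  shows "Z = {vec.span {v}} \<or> (\<exists>K P c. euler_chart (\<Union> Z) K P v l c)"
proof -
  let ?x = "vec.span {v}"
  have sub: "multiplicative_subgroup \<rho>" and inv: "\<And>t. t \<noteq> 0 \<Longrightarrow> proj_map (\<rho> t) ` Z = Z"
    and fixed: "?x \<in> fixed_points \<rho> Z" and isolated: "openin (subtopology zariski (fixed_points \<rho> Z)) {?x}"
    and iso: "isotropy_scalar Z ?x (\<rho> 2)"
    using \<rho> by (auto simp: euler_type_def)
  have xZ: "?x \<in> Z" using fixed by (simp add: fixed_points_def)
  then have vS: "v \<in> \<Union> Z" using span_in_Z[OF v] by simp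
  obtain K P where g: "grading K P" and \<rho>_act: "\<And>t y. t \<noteq> 0 \<Longrightarrow> \<rho> t *v y = grading.act K P t y"
    using multiplicative_subgroup_grading[OF sub] by metis
  interpret grading K P by (rule g)
  have act_S: "act t y \<in> \<Union> Z" if t: "t \<noteq> 0" and y: "y \<in> \<Union> Z" for t y
  proof -
    obtain L where L: "L \<in> Z" "y \<in> L" using y by blast
    then have "proj_map (\<rho> t) L \<in> Z" using inv[OF t] by blast
    then have "(\<lambda>v. \<rho> t *v v) ` L \<in> Z" using Z_proj[OF L(1)] by (simp add: proj_map_def)
    then show ?thesis using L(2) \<rho>_act[OF t] by (metis UnionI image_eqI)
  qed
  obtain \<alpha> \<gamma> where \<alpha>: "\<And>u. u \<in> ?x \<Longrightarrow> \<rho> 2 *v u = \<alpha> *s u"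
      "\<And>w. w \<in> cone_tangent_space Z ?x \<Longrightarrow> inverse \<alpha> *s (\<rho> 2 *v w) - \<gamma> *s w \<in> ?x"
    using iso by (auto simp: isotropy_scalar_def)
  have "act 2 v = \<alpha> *s v" using \<alpha>(1)[OF vec.span_base] by (simp add: \<rho>_act)
  then obtain m where m: "P m *v v = v" "\<alpha> = 2 powi m" using eigenvector_weight v by metis
  have twisted: "graded_cone (\<Union> Z) ((\<lambda>k. e * (k - m)) ` K) (\<lambda>k. P (m + e * k))"
    if e: "e = 1 \<or> e = (- 1 :: int)" for e
  proof (intro graded_cone.intro cone twisted_grading(1)[OF e] graded_cone_axioms.intro)
    fix t y assume t: "t \<noteq> (0::complex)" and y: "y \<in> \<Union> Z"
    show "grading.act ((\<lambda>k. e * (k - m)) ` K) (\<lambda>k. P (m + e * k)) t y \<in> \<Union> Z"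
      unfolding twisted_grading(2)[OF e t] using scale[OF act_S[OF _ y]] t by simp
  qed
  have "inverse (2 powi m) *s act 2 w - \<gamma> *s w \<in> ?x" if "w \<in> tangent (\<Union> Z) v" for w
    using \<alpha>(2)[of w] tangent_subset_cone_tangent_space[of v] that m(2) by (auto simp: \<rho>_act)
  from isotropy_weight[OF m(1), of "tangent (\<Union> Z) v", OF this]
  consider (fixed) "\<And>w. w \<in> tangent (\<Union> Z) v \<Longrightarrow> P m *v w = w"
    | (weight) d where "d \<noteq> 0" "\<And>w. w \<in> tangent (\<Union> Z) v \<Longrightarrow> \<exists>a. w = a *s v + P (m + d) *v w"
    by blast
  then show ?thesis
  proof cases
    case weight
    \<comment> \<open>This sign makes the tangent weight positive.\<close>
    define e where "e = sgn d"
    have e: "e = 1 \<or> e = - 1" using weight(1) by (auto simp: e_def sgn_if)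
    have d: "e * \<bar>d\<bar> = d" by (simp add: e_def sgn_mult_abs)
    have "euler_chart (\<Union> Z) ((\<lambda>k. e * (k - m)) ` K) (\<lambda>k. P (m + e * k)) v l (nat \<bar>d\<bar>)"
      using weight by (intro euler_chart.intro twisted[OF e] euler_chart_axioms.intro vS l)
        (simp_all add: m(1) d)
    then show ?thesis by blast
  next
    case fixed
    \<comment> \<open>Both orientations of the torus are admissible in
      \<open>no_negative_weights\<close>, so the weights on either side of \<open>m\<close> are
      excluded.\<close>
    have "P k *v y = 0" if "k \<noteq> m" "y \<in> \<Union> Z" for k y
    proof -
      define e where "e = sgn (m - k)"
      have e: "e = 1 \<or> e = - 1" using that(1) by (auto simp: e_def sgn_if)
      have "e * \<bar>m - k\<bar> = m - k" by (simp add: e_def sgn_mult_abs)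
      then have k: "m + e * (- \<bar>m - k\<bar>) = k" by simp
      have "P (m + e * (- \<bar>m - k\<bar>)) *v y = 0"
        by (rule graded_cone.no_negative_weights[OF twisted[OF e] vS _ _ that(2)])
          (use that(1) fixed m(1) in auto)
      then show ?thesis unfolding k .
    qed
    then have act: "act t y = t powi m *s y" if "y \<in> \<Union> Z" for t y
      using that by - (rule P_ext, metis P_act vec.scale vec.scale_zero_right)
    have "fixed_points \<rho> Z = Z"
    proof -
      have "proj_map (\<rho> t) L = L" if L: "L \<in> Z" and t: "t \<noteq> 0" for L t
      proof -
        obtain y where y: "y \<noteq> 0" "L = vec.span {y}" "y \<in> \<Union> Z" using Z_span[OF L] .
        have "vec.subspace L" by (simp add: y(2))
        have "\<rho> t *v u = t powi m *s u" if "u \<in> L" for u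
          using that L t act by (metis UnionI \<rho>_act)
        then have "(\<lambda>v. \<rho> t *v v) ` L = (\<lambda>v. t powi m *s v) ` L" by (intro image_cong) auto
        also have "\<dots> = L"
        proof
          show "(\<lambda>v. t powi m *s v) ` L \<subseteq> L" using vec.subspace_scale[OF \<open>vec.subspace L\<close>] by auto
          show "L \<subseteq> (\<lambda>v. t powi m *s v) ` L"
          proof
            fix u assume "u \<in> L"
            then have "inverse (t powi m) *s u \<in> L" by (rule vec.subspace_scale[OF \<open>vec.subspace L\<close>])
            moreover have "u = t powi m *s (inverse (t powi m) *s u)" using t by simp
            ultimately show "u \<in> (\<lambda>v. t powi m *s v) ` L" by (rule rev_image_eqI)
          qed
        qed
        finally show ?thesis using Z_proj[OF L] by (simp add: proj_map_def)
      qed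
      then show ?thesis by (auto simp: fixed_points_def)
    qed
    with isolated have "openin (subtopology zariski Z) {?x}" by simp
    then obtain T where T: "openin zariski T" "{?x} = T \<inter> Z" by (auto simp: openin_subtopology)
    then obtain R where R: "R \<subseteq> homogeneous_polys" "proj_space - T = zero_locus R"
      by (auto simp: openin_zariski)
    have "?x \<notin> zero_locus R" using T(2) R(2) by blast
    then obtain h where h: "h \<in> R" "h v \<noteq> 0"
      using span_in_proj_space[OF v] R(1) by (auto simp: zero_locus_def vanishes_at_span v)
    have hh: "h \<in> homogeneous_polys" using h R by blast
    have h0: "h y = 0" if "y \<in> \<Union> Z" "y \<notin> ?x" for y
    proof -
      have "y \<noteq> 0" using that(2) vec.span_zero by blast
      then have "vec.span {y} \<in> Z" using span_in_Z that(1) by blast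
      moreover have "vec.span {y} \<noteq> ?x" using that(2) vec.span_base[of y "{y}"] by auto
      ultimately have "vec.span {y} \<in> zero_locus R" using T(2) R(2) Z_proj by blast
      then show ?thesis using h(1) vanishes_at_span[OF hh \<open>y \<noteq> 0\<close>] by (simp add: zero_locus_def)
    qed
    \<comment> \<open>On the cone, \<open>h\<close> vanishes off the line of \<open>v\<close>, while
      \<open>w\<close> gives a linear form vanishing on this line. Their product is zero although
      neither factor is, against primality.\<close>
    have sub: "y \<in> ?x" if y: "y \<in> \<Union> Z" for y
    proof (rule ccontr)
      assume "y \<notin> ?x"
      then obtain w where w: "\<And>u. u \<in> ?x \<Longrightarrow> pairing u w = 0" "pairing y w \<noteq> 0"
        using pairing_separation[OF vec.subspace_span] by metis
      have "h z * pairing w z = 0" if "z \<in> \<Union> Z" for z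
        using h0[OF that] w(1)[of z] by (auto simp: pairing_commute)
      then have "(\<forall>z\<in>\<Union> Z. h z = 0) \<or> (\<forall>z\<in>\<Union> Z. pairing w z = 0)"
        using prime[OF hh pairing_homogeneous] by blast
      with h(2) vS w(2) y show False by (metis pairing_commute)
    qed
    have "L = ?x" if L: "L \<in> Z" for L
    proof -
      obtain y where y: "y \<noteq> 0" "L = vec.span {y}" "y \<in> \<Union> Z" using Z_span[OF L] .
      show ?thesis
        using proj_space_line[OF span_in_proj_space[OF v] sub[OF y(3)] y(1)] y(2) by simp
    qed
    then show ?thesis using xZ by blast
  qed
qed

section \<open>Automorphisms, open orbits and density\<close>

lemma proj_map_in_Aut:
  assumes "invertible g" "(*v) g ` \<Union> Z = \<Union> Z"
  shows "proj_map g \<in> Aut Z"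
proof -
  obtain g' where g': "g' ** g = mat 1" using assms(1) by (auto simp: invertible_def)
  have inj: "y = 0" if "g *v y = 0" for y
    using that g' by (metis matrix_vector_mul_assoc matrix_vector_mul_lid matrix_vector_mult_0_right)
  have img: "proj_map g (vec.span {y}) = vec.span {g *v y}" if "y \<noteq> 0" for y
    using span_in_proj_space[OF that] by (simp add: proj_map_def vec.span_singleton vec.scale image_image)
  have "proj_map g ` Z = Z"
  proof
    show "proj_map g ` Z \<subseteq> Z"
    proof
      fix L assume "L \<in> proj_map g ` Z"
      then obtain L' where L': "L' \<in> Z" "L = proj_map g L'" by blast
      obtain y where y: "y \<noteq> 0" "L' = vec.span {y}" "y \<in> \<Union> Z" using Z_span[OF L'(1)] .
      have "g *v y \<in> \<Union> Z" using assms(2) y(3) by blast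
      then show "L \<in> Z" using L'(2) y inj img[OF y(1)] span_in_Z by metis
    qed
    show "Z \<subseteq> proj_map g ` Z"
    proof
      fix L assume "L \<in> Z"
      then obtain y where y: "y \<noteq> 0" "L = vec.span {y}" "y \<in> \<Union> Z" using Z_span by blast
      then obtain y' where y': "y' \<in> \<Union> Z" "y = g *v y'" using assms(2) by blast
      have "y' \<noteq> 0" using y(1) y'(2) by auto
      then show "L \<in> proj_map g ` Z" using img y(2) y' span_in_Z by (metis image_eqI)
    qed
  qed
  then show ?thesis using assms(1) by (auto simp: Aut_def PGL_def)
qed

lemma Aut_compose:
  assumes "\<phi> \<in> Aut Z" "\<psi> \<in> Aut Z" "L \<in> Z"
  shows "\<phi> (\<psi> L) \<in> Aut_orbit Z L"
proof -
  obtain g h where g: "\<phi> = proj_map g" "invertible g" and h: "\<psi> = proj_map h" "invertible h"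
    using assms by (auto simp: Aut_def PGL_def)
  have Z: "\<phi> ` Z = Z" "\<psi> ` Z = Z" using assms by (auto simp: Aut_def)
  have comp: "proj_map (g ** h) L = \<phi> (\<psi> L)" if "L \<in> Z" for L
  proof -
    have "\<psi> L \<in> Z" using Z that by blast
    then show ?thesis
      using Z_proj[OF that] Z_proj[of "\<psi> L"]
      by (simp add: g h proj_map_def image_image matrix_vector_mul_assoc)
  qed
  then have "proj_map (g ** h) ` Z = \<phi> ` \<psi> ` Z" by (simp add: image_image)
  then have "proj_map (g ** h) ` Z = Z" using Z by simp
  moreover have "invertible (g ** h)" using g h by (simp add: invertible_mult)
  ultimately have "proj_map (g ** h) \<in> Aut Z" by (auto simp: Aut_def PGL_def)
  then show ?thesis using comp[OF assms(3)] unfolding Aut_orbit_def by (metis (mono_tags, lifting) mem_Collect_eq)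
qed

lemma Aut_orbit_subset: "L \<in> Z \<Longrightarrow> Aut_orbit Z L \<subseteq> Z"
  by (auto simp: Aut_orbit_def Aut_def)

lemma self_in_Aut_orbit: "L \<in> Z \<Longrightarrow> L \<in> Aut_orbit Z L"
proof -
  assume L: "L \<in> Z"
  have "proj_map (mat 1) \<in> Aut Z" by (rule proj_map_in_Aut) (auto simp: invertible_def intro: exI[of _ "mat 1"])
  moreover have "proj_map (mat 1) L = L" using Z_proj[OF L] by (simp add: proj_map_def)
  ultimately show ?thesis unfolding Aut_orbit_def by (metis (mono_tags, lifting) mem_Collect_eq)
qed

lemma topspace_Z: "topspace (subtopology zariski Z) = Z"
  using Z_proj by (auto simp: topspace_zariski)

text \<open>\<open>Z\<close> is the union of the closure of \<open>U\<close> and the complement of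
  \<open>U\<close>; the latter is a proper closed subset, so irreducibility leaves the
  former.\<close>

lemma closure_of_open:
  assumes "openin (subtopology zariski Z) U" "U \<noteq> {}"
  shows "(subtopology zariski Z) closure_of U = Z"
proof -
  let ?X = "subtopology zariski Z"
  have Z: "closedin zariski Z" using var by (simp add: irreducible_closed_def)
  have U: "U \<subseteq> Z" using openin_subset[OF assms(1)] topspace_Z by simp
  have "closedin zariski (?X closure_of U)" "closedin zariski (Z - U)"
    using closedin_trans_full[OF _ Z] closedin_closure_of closedin_diff[OF closedin_topspace assms(1)] topspace_Z
    by metis+
  moreover have "Z = ?X closure_of U \<union> (Z - U)"
    using closure_of_subset[of U ?X] closure_of_subset_topspace[of ?X U] U topspace_Z by auto
  ultimately have "Z = ?X closure_of U \<or> Z = Z - U" using var unfolding irreducible_closed_def by blast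
  then show ?thesis using U assms(2) by auto
qed

lemma openin_nonvanishing:
  assumes "f \<in> homogeneous_polys"
  shows "openin (subtopology zariski Z) {L\<in>Z. \<not> vanishes_at f L}"
proof -
  have "proj_space - {L\<in>proj_space. \<not> vanishes_at f L} = zero_locus {f}"
    by (auto simp: zero_locus_def)
  then have "openin zariski {L\<in>proj_space. \<not> vanishes_at f L}"
    using assms by (auto simp: openin_zariski)
  moreover have "{L\<in>Z. \<not> vanishes_at f L} = {L\<in>proj_space. \<not> vanishes_at f L} \<inter> Z"
    using Z_proj by auto
  ultimately show ?thesis by (auto simp: openin_subtopology)
qed

text \<open>The orbit contains the chart where \<open>b\<close> is nonzero. Being covered by
  translates of this chart it is open, and then dense by irreducibility.\<close>

lemma quasi_homogeneousI:
  assumes v: "v \<in> \<Union> Z" "pairing b v = 1"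
    and orbit: "\<And>y. y \<in> \<Union> Z \<Longrightarrow> pairing b y \<noteq> 0 \<Longrightarrow>
      \<exists>g a. invertible g \<and> (*v) g ` \<Union> Z = \<Union> Z \<and> a \<noteq> 0 \<and> g *v v = a *s y"
  shows "quasi_homogeneous Z"
proof -
  let ?x = "vec.span {v}"
  have v0: "v \<noteq> 0" using v(2) by (auto simp: pairing_zero_right)
  have x: "?x \<in> Z" using v(1) span_in_Z[OF v0] by simp
  have chart: "\<exists>\<psi>\<in>Aut Z. L = \<psi> ?x" if L: "L \<in> Z" "\<not> vanishes_at (pairing b) L" for L
  proof -
    obtain y where y: "y \<noteq> 0" "L = vec.span {y}" "y \<in> \<Union> Z" using Z_span[OF L(1)] .
    have "pairing b y \<noteq> 0" using L(2) y by (simp add: vanishes_at_span[OF pairing_homogeneous])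
    then obtain g a where g: "invertible g" "(*v) g ` \<Union> Z = \<Union> Z" "a \<noteq> 0" "g *v v = a *s y"
      using orbit[OF y(3)] by blast
    have "proj_map g ?x \<in> Z" using proj_map_in_Aut[OF g(1,2)] x by (auto simp: Aut_def)
    moreover have "a *s y \<in> proj_map g ?x"
      using g(4) span_in_proj_space[OF v0] vec.span_base[of v "{v}"] by (force simp: proj_map_def)
    moreover have "a *s y \<noteq> 0" using g(3) y(1) by simp
    ultimately have "proj_map g ?x = vec.span {a *s y}" by (intro proj_space_line Z_proj)
    moreover have "L = vec.span {a *s y}"
      using y \<open>a *s y \<noteq> 0\<close> by (intro proj_space_line Z_proj L) (auto simp: vec.span_singleton)
    ultimately show ?thesis using proj_map_in_Aut[OF g(1,2)] by metis
  qed
  have "openin (subtopology zariski Z) (Aut_orbit Z ?x)"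
  proof (subst openin_subopen, intro ballI)
    fix L assume "L \<in> Aut_orbit Z ?x"
    then obtain \<phi> where \<phi>: "\<phi> \<in> Aut Z" "L = \<phi> ?x" by (auto simp: Aut_orbit_def)
    then obtain g where g: "\<phi> = proj_map g" "invertible g" by (auto simp: Aut_def PGL_def)
    then obtain g' where g': "g' ** g = mat 1" by (auto simp: invertible_def)
    have gg: "g' *v (g *v w) = w" for w by (simp add: matrix_vector_mul_assoc g')
    \<comment> \<open>\<open>f\<close> is the form \<open>b\<close> transported by
      \<open>\<phi>\<close>, so its nonvanishing locus is the translate of the chart that contains
      \<open>L\<close>.\<close>
    define f where "f = (\<lambda>w. pairing b (g' *v w))"
    have "f \<in> homogeneous_polys"
    proof -
      have "(\<lambda>w. pairing b (g' *v w)) \<in> poly_funs"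
        using pairing_homogeneous[of b] poly_funs_subst[OF _ poly_funs_matrix] by (auto simp: homogeneous_polys_def)
      then show ?thesis
        by (auto simp: homogeneous_polys_def f_def vec.scale pairing_scale_right intro!: exI[of _ 1])
    qed
    let ?T = "{L\<in>Z. \<not> vanishes_at f L}"
    have image: "\<phi> L' = (*v) g ` L'" if "L' \<in> Z" for L'
      using Z_proj[OF that] by (simp add: g proj_map_def)
    have "openin (subtopology zariski Z) ?T" by (rule openin_nonvanishing) fact
    moreover have "L \<in> ?T"
    proof -
      have "f (g *v v) \<noteq> 0" by (simp add: f_def gg v)
      moreover have "g *v v \<in> L" using \<phi>(2) image[OF x] vec.span_base[of v "{v}"] by auto
      moreover have "L \<in> Z" using Aut_orbit_subset[OF x] \<open>L \<in> Aut_orbit Z ?x\<close> by blast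
      ultimately show ?thesis by (auto simp: vanishes_at_def)
    qed
    moreover have "?T \<subseteq> Aut_orbit Z ?x"
    proof
      fix M assume M: "M \<in> ?T"
      then obtain M' where M': "M' \<in> Z" "M = \<phi> M'" using \<phi>(1) by (auto simp: Aut_def)
      have "\<not> vanishes_at (pairing b) M'"
        using M unfolding M'(2) image[OF M'(1)] by (auto simp: vanishes_at_def f_def gg)
      then obtain \<psi> where "\<psi> \<in> Aut Z" "M' = \<psi> ?x" using chart[OF M'(1)] by blast
      then show "M \<in> Aut_orbit Z ?x" using Aut_compose[OF \<phi>(1) _ x] M'(2) by simp
    qed
    ultimately show "\<exists>T. openin (subtopology zariski Z) T \<and> L \<in> T \<and> T \<subseteq> Aut_orbit Z ?x" by blast
  qed
  moreover from this have "(subtopology zariski Z) closure_of (Aut_orbit Z ?x) = Z"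
    using self_in_Aut_orbit[OF x] by (intro closure_of_open) auto
  ultimately show ?thesis using x unfolding quasi_homogeneous_def by blast
qed

end

theorem proposition2p3:
  fixes Z :: "(complex ^ 'n) set set"
  assumes "projective_variety Z" and "euler_symmetric Z"
  shows "quasi_homogeneous Z"
proof -
  interpret variety Z by unfold_locales (rule assms)
  obtain U where U: "openin (subtopology zariski Z) U" "U \<noteq> {}" "\<And>x. x \<in> U \<Longrightarrow> \<exists>\<rho>. euler_type \<rho> Z x"
    using assms(2) unfolding euler_symmetric_def by blast
  then obtain T where T: "openin zariski T" "U = T \<inter> Z" by (auto simp: openin_subtopology)
  then obtain R where R: "R \<subseteq> homogeneous_polys" "proj_space - T = zero_locus R"
    by (auto simp: openin_zariski)
  obtain x where x: "x \<in> U" using U(2) by blast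
  then have xZ: "x \<in> Z" and "x \<notin> zero_locus R" using T R by auto
  \<comment> \<open>One equation \<open>h\<close> that is nonzero at \<open>x\<close> shrinks
    \<open>U\<close> to the open set where \<open>h\<close> does not vanish, which still consists of
    Euler points.\<close>
  then obtain h where h: "h \<in> R" "\<not> vanishes_at h x" using Z_proj by (auto simp: zero_locus_def)
  have hh: "h \<in> homogeneous_polys" using h R by blast
  obtain v where v: "v \<noteq> 0" "x = vec.span {v}" "v \<in> \<Union> Z" using Z_span[OF xZ] .
  have hv: "h v \<noteq> 0" using h(2) v by (simp add: vanishes_at_span[OF hh])
  have euler: "\<exists>\<rho>. euler_type \<rho> Z (vec.span {y})" if y: "y \<in> \<Union> Z" "y \<noteq> 0" "h y \<noteq> 0" for y
  proof (rule U(3))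
    have yZ: "vec.span {y} \<in> Z" using y span_in_Z by blast
    moreover have "vec.span {y} \<notin> zero_locus R"
      using y vanishes_at_span[OF hh y(2)] h(1) by (auto simp: zero_locus_def)
    ultimately show "vec.span {y} \<in> U" using T(2) R(2) Z_proj by blast
  qed
  \<comment> \<open>A single point is its own orbit. Otherwise \<open>euler_point_chart\<close>
    provides a chart at every vector of the cone where \<open>h\<close> is nonzero.\<close>
  show ?thesis
  proof (cases "Z = {x}")
    case True
    then have "Aut_orbit Z x = Z" using Aut_orbit_subset[OF xZ] self_in_Aut_orbit[OF xZ] by auto
    then show ?thesis
      using xZ openin_topspace[of "subtopology zariski Z"] closure_of_topspace[of "subtopology zariski Z"]
      unfolding quasi_homogeneous_def topspace_Z by (intro bexI[of _ x]) auto
  next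
    case False
    have charts: "\<exists>K P c. euler_chart (\<Union> Z) K P y l c"
      if y: "y \<in> \<Union> Z" "y \<noteq> 0" "h y \<noteq> 0" "pairing l y = 1" for y l
    proof -
      obtain \<rho> where "euler_type \<rho> Z (vec.span {y})" using euler[OF y(1-3)] by blast
      moreover have "Z \<noteq> {vec.span {y}}" using False xZ by auto
      ultimately show ?thesis using euler_point_chart y by blast
    qed
    obtain u b where "u \<in> \<Union> Z" "pairing b u = 1" "\<And>y. y \<in> \<Union> Z \<Longrightarrow> pairing b y \<noteq> 0 \<Longrightarrow>
        \<exists>g a. invertible g \<and> (*v) g ` \<Union> Z = \<Union> Z \<and> a \<noteq> 0 \<and> g *v u = a *s y"
      using cone_has_large_orbit[OF hh _ charts] v hv by blast
    then show ?thesis by (rule quasi_homogeneousI)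
  qed
qed

end
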